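(* Let $r,k,n$ be integers with $r\ge 3$, $r\le k\le 2r-1$ and $$n\ge (2r-k-1)\left(\mathrm{e}\,r^4k^{\frac{k}{2}}\right)^{\frac{k}{2k-2r+1}}+k .$$ Let $G$ be a $2K_r$-free graph on $n$ vertices. Then $$\mu_k(G)+\mu_{k+1}(G)+\cdots+\mu_{2r-1}(G)\le \mu_k\bigl(K_{2k-2r+1}\vee T_{2r-k-1}(n-2k+2r-1)\bigr).$$ Moreover: (i) for $k=2r-1$, equality holds if and only if $|C_k(G)|=1$; (ii) for $r\le k\le 2r-2$, equality holds if and only if $G\cong K_{2k-2r+1}\vee T_{2r-k-1}(n-2k+2r-1)$.
   Context: All graphs are finite, undirected and simple. $\mathrm{e}$ is the base of the natural logarithm. $2K_r$ is the disjoint union of two copies of the complete graph $K_r$. A graph is $F$-free if it does not contain $F$ as a (not necessarily induced) subgraph. $G\vee H$ is the join: the disjoint union of $G$ and $H$ together with all edges between $V(G)$ and $V(H)$. $T_s(m)$ is the complete $s$-partite graph on $m$ vertices in which no two part sizes differ by more than one ($T_1(m)$ is the edgeless graph on $m$ vertices). When $k=2r-1$ the index of $T_{2r-k-1}$ is $0$; then $T_0$ is taken to be the graph with no vertices, so the right-hand side is $\mu_{2r-1}(K_{2r-1})$. An $s$-clique of $G$ is an $s$-element subset of $V(G)$ inducing a complete graph, and $C_s(G)$ is the set of all $s$-cliques of $G$. For $s\ge2$ and $G$ with vertex set $\{1,\dots,n\}$, the $s$-clique tensor $\mathcal{A}_s(G)=(a_{i_1\cdots i_s})$ is the order-$s$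 dimension-$n$ tensor with $a_{i_1\cdots i_s}=\frac{1}{(s-1)!}$ if $\{i_1,\dots,i_s\}\in C_s(G)$ and $0$ otherwise. For an order-$s$ dimension-$n$ tensor $\mathcal{A}=(a_{i_1\cdots i_s})$, a complex number $\lambda$ is an eigenvalue if there is a nonzero $x\in\mathbb{C}^n$ with $\sum_{i_2,\dots,i_s=1}^n a_{i i_2\cdots i_s}x_{i_2}\cdots x_{i_s}=\lambda x_i^{s-1}$ for all $i$; the spectral radius of $\mathcal{A}$ is the maximum modulus of its eigenvalues. The $s$-clique spectral radius $\mu_s(G)$ is the spectral radius of $\mathcal{A}_s(G)$. *)

theory Defs
  imports Complex_Main "HOL-Library.Ramsey"
begin

record 'a sgraph =
  verts :: "'a set"
  edges :: "'a set set"

definition simple_graph :: "'a sgraph \<Rightarrow> bool" where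
  "simple_graph G \<longleftrightarrow> finite (verts G) \<and> edges G \<subseteq> [verts G]\<^bsup>2\<^esup>"

(* Containment as a not necessarily induced subgraph. *)
definition contains_subgraph :: "'a sgraph \<Rightarrow> 'b sgraph \<Rightarrow> bool" where
  "contains_subgraph G F \<longleftrightarrow>
     (\<exists>f. inj_on f (verts F) \<and> f ` verts F \<subseteq> verts G \<and> (\<forall>e\<in>edges F. f ` e \<in> edges G))"

definition graph_iso :: "'a sgraph \<Rightarrow> 'b sgraph \<Rightarrow> bool" where
  "graph_iso G H \<longleftrightarrow>
     (\<exists>f. bij_betw f (verts G) (verts H) \<and>
       (\<forall>u\<in>verts G. \<forall>v\<in>verts G. {u, v} \<in> edges G \<longleftrightarrow> {f u, f v} \<in> edges H))"

definition complete_graph :: "nat \<Rightarrow> nat sgraph" where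
  "complete_graph m = \<lparr>verts = {..<m}, edges = [{..<m}]\<^bsup>2\<^esup>\<rparr>"

definition disjoint_union :: "'a sgraph \<Rightarrow> 'b sgraph \<Rightarrow> ('a + 'b) sgraph" where
  "disjoint_union G H =
     \<lparr>verts = verts G <+> verts H,
      edges = (`) Inl ` edges G \<union> (`) Inr ` edges H\<rparr>"

definition graph_join :: "'a sgraph \<Rightarrow> 'b sgraph \<Rightarrow> ('a + 'b) sgraph" where
  "graph_join G H =
     \<lparr>verts = verts (disjoint_union G H),
      edges = edges (disjoint_union G H) \<union>
        {{Inl u, Inr v} | u v. u \<in> verts G \<and> v \<in> verts H}\<rparr>"

(* T_s(m) on the vertices 0, ..., m-1. The parts are the residue classes modulo s, whose
   sizes differ by at most one. T_0(m) is by convention the graph with no vertices,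
   for every m. *)
definition turan_graph :: "nat \<Rightarrow> nat \<Rightarrow> nat sgraph" where
  "turan_graph s m =
     (if s = 0 then \<lparr>verts = {}, edges = {}\<rparr>
      else \<lparr>verts = {..<m}, edges = {{u, v} | u v. u < m \<and> v < m \<and> u mod s \<noteq> v mod s}\<rparr>)"

definition cliques :: "nat \<Rightarrow> 'a sgraph \<Rightarrow> 'a set set" where
  "cliques s G = {S \<in> [verts G]\<^bsup>s\<^esup>. clique S (edges G)}"

(* A tensor of order s indexed by a finite set V (in place of {1..n}) is a function on index
   lists; only its values on lists of length s over V matter. *)

definition clique_tensor :: "nat \<Rightarrow> 'a sgraph \<Rightarrow> 'a list \<Rightarrow> complex" where
  "clique_tensor s G idx = (if set idx \<in> cliques s G then 1 / fact (s - 1) else 0)"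

definition tensor_eigenvalue :: "nat \<Rightarrow> 'a set \<Rightarrow> ('a list \<Rightarrow> complex) \<Rightarrow> complex \<Rightarrow> bool" where
  "tensor_eigenvalue s V A l \<longleftrightarrow>
     (\<exists>x :: 'a \<Rightarrow> complex. (\<exists>i\<in>V. x i \<noteq> 0) \<and>
       (\<forall>i\<in>V. (\<Sum>js | set js \<subseteq> V \<and> length js = s - 1. A (i # js) * (\<Prod>j\<leftarrow>js. x j))
              = l * x i ^ (s - 1)))"

(* For finite V the moduli of the eigenvalues form a compact set, so the maximum is attained
   as soon as there is an eigenvalue; clique tensors of order s >= 3 on a nonempty V have
   the eigenvalue 0, with the unit vectors as eigenvectors. *)
definition tensor_spectral_radius :: "nat \<Rightarrow> 'a set \<Rightarrow> ('a list \<Rightarrow> complex) \<Rightarrow> real" where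
  "tensor_spectral_radius s V A = (GREATEST \<rho>. \<exists>l. tensor_eigenvalue s V A l \<and> \<rho> = cmod l)"

definition clique_spectral_radius :: "nat \<Rightarrow> 'a sgraph \<Rightarrow> real" where
  "clique_spectral_radius s G = tensor_spectral_radius s (verts G) (clique_tensor s G)"

end

theory Submission
  imports Defs "HOL-Analysis.Analysis" "HOL-Combinatorics.Multiset_Permutations"
begin

text \<open>
  Let \<open>t = 2 * k + 1 - 2 * r\<close> and \<open>s = 2 * r - k - 1\<close>, so that \<open>k = t + s\<close>. Two cliques of size at least \<open>r\<close> whose
  union has \<open>2 * r\<close> vertices contain two disjoint copies of the complete graph on \<open>r\<close> vertices
  (\<open>two_disjoint_cliques_contained\<close>). Hence, in the given graph, any two cliques of size at least \<open>k\<close> have a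
  union of at most \<open>k + s\<close> vertices; in particular any two \<open>k\<close>-cliques share at least \<open>t\<close> vertices. The
  extremal graph realises this in the obvious way: all its \<open>k\<close>-cliques contain the same \<open>t\<close> vertices.
  
  The spectral side reduces to counting. An eigenvalue equation of the clique tensor is an equation
  between sums over cliques, and it yields \<open>\<mu>\<^sub>p \<le> N\<^sub>p\<close> for the number \<open>N\<^sub>p\<close> of \<open>p\<close>-cliques. If there is no
  \<open>(p + 1)\<close>-clique, the Motzkin--Straus inequality \<open>clique_polynomial_le\<close> improves this to
  \<open>\<mu>\<^sub>p ^ p \<le> N\<^sub>p ^ (p - 1)\<close>, with equality for complete \<open>p\<close>-partite graphs. The extremal graph is complete
  \<open>k\<close>-partite, so with \<open>P\<close> the product of the part sizes of its Turan factor, its spectral radius \<open>\<mu>\<close>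
  satisfies \<open>\<mu> ^ k = P ^ (k - 1)\<close>. All comparisons are made between \<open>k\<close>-th powers, which avoids fractional exponents.
  
  Suppose first that all \<open>k\<close>-cliques contain a common set \<open>T\<close> of \<open>t\<close> vertices. Then there are no larger
  cliques, and the \<open>k\<close>-cliques correspond to \<open>s\<close>-cliques in the common neighbourhood of \<open>T\<close>, which has
  no \<open>(s + 1)\<close>-clique. By Zykov's theorem (\<open>zykov_clique_bound\<close>) and the optimality of balanced parts
  there are at most \<open>P\<close> of them, with equality only for the extremal graph.
  
  Otherwise the cliques of size at least \<open>k\<close> are few. Relative to a fixed \<open>k\<close>-clique, each of them is given by
  boundedly many choices and at most \<open>s - 1\<close> free vertices (\<open>card_nonstar_family\<close>), whereas \<open>P\<close> grows like
  the \<open>s\<close>-th power of \<open>n\<close>. The hypothesis on \<open>n\<close> makes the total number of these cliques smaller than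
  the spectral radius of the extremal graph (\<open>nonstar_count_power_le\<close>), so the inequality is strict.
  
  For \<open>s = 0\<close>, that is \<open>k = 2 * r - 1\<close>, the union bound leaves room for one \<open>k\<close>-clique only.
\<close>

section \<open>Inequalities between means\<close>

text \<open>
  The inequality of arithmetic and geometric means, in power form so that no roots appear.
  With mean \<open>m\<close>, multiply the bounds \<open>y i / m \<le> exp (y i / m - 1)\<close>: the exponents sum to zero.
\<close>

lemma prod_le_mean_power:
  fixes y :: "'a \<Rightarrow> real"
  assumes "finite K" and "K \<noteq> {}" and "\<And>i. i \<in> K \<Longrightarrow> 0 \<le> y i"
  shows "(\<Prod>i\<in>K. y i) \<le> (sum y K / card K) ^ card K"
proof -
  define m where "m = sum y K / card K"
  have cpos: "card K > 0" using assms by (simp add: card_gt_0_iff)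
  have "m \<ge> 0" unfolding m_def using assms by (simp add: sum_nonneg)
  show ?thesis
  proof (cases "m = 0")
    case True
    then have "sum y K = 0" using cpos by (simp add: m_def)
    then have "\<forall>i\<in>K. y i = 0" using assms by (simp add: sum_nonneg_eq_0_iff)
    then have "(\<Prod>i\<in>K. y i) = 0" using assms by (meson ex_in_conv prod_zero)
    then show ?thesis using \<open>m \<ge> 0\<close> by (simp add: m_def)
  next
    case False
    then have "m > 0" using \<open>m \<ge> 0\<close> by simp
    have "y i \<le> m * exp (y i / m - 1)" for i
    proof -
      have "y i / m \<le> exp (y i / m - 1)" using exp_ge_add_one_self[of "y i / m - 1"] by simp
      then show ?thesis using \<open>m > 0\<close> by (simp add: field_simps)
    qed
    then have "(\<Prod>i\<in>K. y i) \<le> (\<Prod>i\<in>K. m * exp (y i / m - 1))"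
      using assms by (intro prod_mono) auto
    also have "\<dots> = m ^ card K * exp (\<Sum>i\<in>K. (y i / m - 1))"
      using assms(1) by (simp add: prod.distrib exp_sum)
    also have "(\<Sum>i\<in>K. (y i / m - 1)) = sum y K / m - card K"
      by (simp add: sum_subtractf sum_divide_distrib)
    also have "sum y K / m = card K"
      using cpos \<open>m > 0\<close> by (simp add: m_def field_simps split: if_splits)
    finally show ?thesis by (simp add: m_def)
  qed
qed

lemma card_times_prod_le_sum_power:
  fixes y :: "'a \<Rightarrow> real"
  assumes "finite K" and "K \<noteq> {}" and "\<And>i. i \<in> K \<Longrightarrow> 0 \<le> y i"
  shows "card K * (\<Prod>i\<in>K. y i) \<le> (\<Sum>i\<in>K. y i ^ card K)"
proof -
  have cpos: "card K > 0" using assms by (simp add: card_gt_0_iff)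
  have "(\<Prod>i\<in>K. y i) ^ card K \<le> ((\<Sum>i\<in>K. y i ^ card K) / card K) ^ card K"
    using prod_le_mean_power[of K "\<lambda>i. y i ^ card K"] assms by (simp add: prod_power_distrib)
  then have "(\<Prod>i\<in>K. y i) \<le> (\<Sum>i\<in>K. y i ^ card K) / card K"
    by (rule power_le_imp_le_base[where n = "card K - 1", unfolded Suc_diff_1[OF cpos]])
       (simp add: assms sum_nonneg)+
  then show ?thesis using cpos by (simp add: field_simps)
qed

text \<open>
  Convexity of the \<open>p\<close>-th power: Bernoulli's inequality says that the graph of the power lies
  above its tangent at the mean, and the linear terms of the tangent cancel in the sum.
\<close>

lemma power_of_sum_le:
  fixes z :: "'a \<Rightarrow> real"
  assumes "finite C" and "\<And>i. i \<in> C \<Longrightarrow> 0 \<le> z i" and "0 < p"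
  shows "(sum z C) ^ p \<le> real (card C) ^ (p - 1) * (\<Sum>i\<in>C. z i ^ p)"
proof (cases "sum z C = 0")
  case True
  have "0 \<le> (\<Sum>i\<in>C. z i ^ p)" using assms by (intro sum_nonneg) auto
  then show ?thesis using True assms by (simp add: zero_power)
next
  case False
  define m where "m = sum z C / card C"
  have cpos: "card C > 0" using False assms(1) by (metis card_gt_0_iff sum.empty)
  have "sum z C > 0" using False assms(2) by (simp add: order_less_le sum_nonneg)
  then have m: "m > 0" using cpos by (simp add: m_def)
  have "m ^ p + real p * m ^ (p - 1) * (z i - m) \<le> z i ^ p" if "i \<in> C" for i
  proof -
    have "-1 \<le> z i / m - 1" using assms(2)[OF that] m by simp
    from Bernoulli_inequality[OF this, of p]
    have "m ^ p * (1 + real p * (z i / m - 1)) \<le> m ^ p * (z i / m) ^ p"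
      using m by simp
    also have "\<dots> = z i ^ p" using m by (simp add: power_divide)
    finally have "m ^ p + real p * (m ^ p * (z i / m - 1)) \<le> z i ^ p"
      by (simp add: algebra_simps)
    moreover have "m ^ p * (z i / m - 1) = m ^ (p - 1) * (z i - m)"
      using m assms(3) by (cases p) (simp_all add: field_simps)
    ultimately show ?thesis by (simp add: mult.assoc)
  qed
  then have "(\<Sum>i\<in>C. m ^ p + real p * m ^ (p - 1) * (z i - m)) \<le> (\<Sum>i\<in>C. z i ^ p)"
    by (rule sum_mono)
  moreover have "(\<Sum>i\<in>C. m ^ p + real p * m ^ (p - 1) * (z i - m)) = card C * m ^ p"
    using cpos by (simp add: sum.distrib sum_distrib_left[symmetric] sum_subtractf m_def)
  ultimately have "card C * m ^ p \<le> (\<Sum>i\<in>C. z i ^ p)" by simp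
  then have "real (card C) ^ (p - 1) * (card C * m ^ p) \<le> real (card C) ^ (p - 1) * (\<Sum>i\<in>C. z i ^ p)"
    by (intro mult_left_mono) auto
  also have "real (card C) ^ (p - 1) * (card C * m ^ p) = (card C * m) ^ p"
    using assms(3) by (cases p) (simp_all add: power_mult_distrib algebra_simps)
  also have "card C * m = sum z C" using cpos by (simp add: m_def)
  finally show ?thesis by simp
qed

section \<open>Cliques and the clique polynomial\<close>

text \<open>
  The edge set stays fixed while the vertex set shrinks to a neighbourhood or to the complement
  of a kernel, so vertex set and edge set are separate arguments here.
\<close>

definition cliques_on :: "nat \<Rightarrow> 'a set \<Rightarrow> 'a set set \<Rightarrow> 'a set set" where
  "cliques_on s U E = {S. S \<subseteq> U \<and> finite S \<and> card S = s \<and> clique S E}"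

lemma cliques_eq_cliques_on: "cliques s G = cliques_on s (verts G) (edges G)"
  by (auto simp: cliques_def cliques_on_def nsets_def)

lemma finite_cliques_on [simp]: "finite U \<Longrightarrow> finite (cliques_on s U E)"
  by (rule finite_subset[of _ "Pow U"]) (auto simp: cliques_on_def)

lemma clique_subset: "clique K E \<Longrightarrow> S \<subseteq> K \<Longrightarrow> clique S E"
  by (auto simp: clique_def)

lemma cliques_onD:
  assumes "K \<in> cliques_on s U E"
  shows "K \<subseteq> U" "finite K" "card K = s" "clique K E"
  using assms by (auto simp: cliques_on_def)

text \<open>
  No clique contains two nonadjacent vertices \<open>u\<close> and \<open>v\<close>, so the clique polynomial is affine in
  the pair of their weights. Moving all weight to the vertex with the larger coefficient
  therefore does not decrease it.
\<close>

lemma clique_polynomial_shift_mono: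
  fixes y :: "'a \<Rightarrow> real"
  assumes "finite U" and uv: "u \<in> U" "v \<in> U" "u \<noteq> v" "{u, v} \<notin> E"
    and y: "\<And>i. i \<in> U \<Longrightarrow> 0 \<le> y i"
    and le: "(\<Sum>K | K \<in> cliques_on k U E \<and> v \<in> K. \<Prod>i\<in>K-{v}. y i)
             \<le> (\<Sum>K | K \<in> cliques_on k U E \<and> u \<in> K. \<Prod>i\<in>K-{u}. y i)"
  shows "(\<Sum>K\<in>cliques_on k U E. \<Prod>i\<in>K. y i)
    \<le> (\<Sum>K\<in>cliques_on k U E. \<Prod>i\<in>K. (y(u := y u + y v, v := 0)) i)"
proof -
  let ?C = "cliques_on k U E"
  let ?z = "y(u := y u + y v, v := 0)"
  define A where "A = {K\<in>?C. u \<in> K}"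
  define B where "B = {K\<in>?C. v \<in> K}"
  define D where "D = {K\<in>?C. u \<notin> K \<and> v \<notin> K}"
  have dis: "A \<inter> B = {}"
    using uv by (auto simp: A_def B_def cliques_on_def clique_def)
  have fin: "finite ?C" using assms(1) by simp
  have eq: "?C = A \<union> B \<union> D" by (auto simp: A_def B_def D_def)
  have finABD: "finite A" "finite B" "finite D" using fin by (auto simp: A_def B_def D_def)
  have split: "(\<Sum>K\<in>?C. f K) = sum f A + sum f B + sum f D" for f :: "'a set \<Rightarrow> real"
    unfolding eq using finABD dis
    by (subst sum.union_disjoint; (subst sum.union_disjoint)?) (auto simp: A_def B_def D_def)
  have "(\<Sum>K\<in>D. \<Prod>i\<in>K. ?z i) = (\<Sum>K\<in>D. \<Prod>i\<in>K. y i)"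
    by (intro sum.cong refl prod.cong) (auto simp: D_def)
  moreover have "(\<Sum>K\<in>B. \<Prod>i\<in>K. ?z i) = 0"
    by (intro sum.neutral ballI prod_zero) (auto simp: B_def cliques_on_def)
  moreover have "(\<Sum>K\<in>A. \<Prod>i\<in>K. ?z i) = (y u + y v) * (\<Sum>K\<in>A. \<Prod>i\<in>K-{u}. y i)"
    unfolding sum_distrib_left
  proof (intro sum.cong refl)
    fix K assume K: "K \<in> A"
    then have "v \<notin> K" using dis by (auto simp: A_def B_def)
    have "finite K" "u \<in> K" using K by (auto simp: A_def cliques_on_def)
    then have "(\<Prod>i\<in>K. ?z i) = ?z u * (\<Prod>i\<in>K-{u}. ?z i)" by (rule prod.remove)
    also have "(\<Prod>i\<in>K-{u}. ?z i) = (\<Prod>i\<in>K-{u}. y i)"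
      using \<open>v \<notin> K\<close> by (intro prod.cong) auto
    finally show "(\<Prod>i\<in>K. ?z i) = (y u + y v) * (\<Prod>i\<in>K-{u}. y i)" using uv by (simp only: fun_upd_apply simp_thms if_False if_True)
  qed
  moreover have "(\<Sum>K\<in>A. \<Prod>i\<in>K. y i) = y u * (\<Sum>K\<in>A. \<Prod>i\<in>K-{u}. y i)"
    unfolding sum_distrib_left
    by (intro sum.cong refl prod.remove) (auto simp: A_def cliques_on_def)
  moreover have "(\<Sum>K\<in>B. \<Prod>i\<in>K. y i) = y v * (\<Sum>K\<in>B. \<Prod>i\<in>K-{v}. y i)"
    unfolding sum_distrib_left
    by (intro sum.cong refl prod.remove) (auto simp: B_def cliques_on_def)
  moreover have "y v * (\<Sum>K\<in>B. \<Prod>i\<in>K-{v}. y i) \<le> y v * (\<Sum>K\<in>A. \<Prod>i\<in>K-{u}. y i)"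
    using le y[OF uv(2)] by (auto simp: A_def B_def intro: mult_left_mono)
  ultimately show ?thesis by (simp add: split algebra_simps)
qed

text \<open>
  A Motzkin--Straus inequality. Shifting weight between nonadjacent vertices shrinks the support
  until it is a clique; without a clique of size \<open>k + 1\<close> at most one monomial survives, and the
  inequality of arithmetic and geometric means bounds it.
\<close>

lemma clique_polynomial_le:
  fixes y :: "'a \<Rightarrow> real"
  assumes "finite U" and "0 < k" and "cliques_on (Suc k) U E = {}"
    and "\<And>i. i \<in> U \<Longrightarrow> 0 \<le> y i"
  shows "(\<Sum>K\<in>cliques_on k U E. \<Prod>i\<in>K. y i) \<le> (sum y U / k) ^ k"
  using assms(4)
proof (induction "card {i\<in>U. y i \<noteq> 0}" arbitrary: y rule: less_induct)
  case less
  let ?C = "cliques_on k U E"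
  let ?S = "{i\<in>U. y i \<noteq> 0}"
  have finS: "finite ?S" using assms(1) by simp
  show ?case
  proof (cases "clique ?S E")
    case True
    have "card ?S \<le> k"
    proof (rule ccontr)
      assume "\<not> card ?S \<le> k"
      then have "Suc k \<le> card ?S" by simp
      then obtain S where "S \<subseteq> ?S" "card S = Suc k" "finite S"
        by (meson obtain_subset_with_card_n)
      then have "S \<in> cliques_on (Suc k) U E"
        using True by (auto simp: cliques_on_def intro: clique_subset)
      then show False using assms(3) by simp
    qed
    have zero: "(\<Prod>i\<in>K. y i) = 0" if "K \<in> ?C - {?S}" for K
    proof -
      have K: "K \<subseteq> U" "finite K" "card K = k" "K \<noteq> ?S" using that by (auto dest: cliques_onD)
      have "\<not> K \<subseteq> ?S" 
        using K \<open>card ?S \<le> k\<close> finS by (metis card_seteq)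
      then show ?thesis using K by (auto intro!: prod_zero)
    qed
    show ?thesis
    proof (cases "?S \<in> ?C")
      case True
      have "(\<Sum>K\<in>?C. \<Prod>i\<in>K. y i) = (\<Sum>K\<in>{?S}. \<Prod>i\<in>K. y i)"
        using zero True assms(1) by (intro sum.mono_neutral_right) auto
      also have "\<dots> \<le> (sum y ?S / k) ^ k"
      proof -
        have "card ?S = k" using True by (rule cliques_onD)
        then have "?S \<noteq> {}" using assms(2) by force
        then show ?thesis
          using prod_le_mean_power[of ?S y] less.prems finS \<open>card ?S = k\<close> by simp
      qed
      also have "sum y ?S = sum y U"
        using assms(1) by (intro sum.mono_neutral_left) auto
      finally show ?thesis .
    next
      case False
      then have "(\<Sum>K\<in>?C. \<Prod>i\<in>K. y i) = 0" using zero by (intro sum.neutral) auto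
      also have "0 \<le> (sum y U / k) ^ k" using less.prems by (simp add: sum_nonneg)
      finally show ?thesis .
    qed
  next
    case False
    have step: ?thesis
      if uv: "u \<in> ?S" "v \<in> ?S" "u \<noteq> v" "{u, v} \<notin> E"
        and le: "(\<Sum>K | K \<in> ?C \<and> v \<in> K. \<Prod>i\<in>K-{v}. y i)
             \<le> (\<Sum>K | K \<in> ?C \<and> u \<in> K. \<Prod>i\<in>K-{u}. y i)" for u v
    proof -
      let ?z = "y(u := y u + y v, v := 0)"
      have pos: "y u > 0" "y v > 0" using uv less.prems by (auto simp: order_less_le)
      have "{i\<in>U. ?z i \<noteq> 0} = ?S - {v}" using uv pos by auto
      then have "card {i\<in>U. ?z i \<noteq> 0} < card ?S"
        using uv finS by (metis (no_types, lifting) card_Diff1_less)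
      then have "(\<Sum>K\<in>?C. \<Prod>i\<in>K. ?z i) \<le> (sum ?z U / k) ^ k"
        by (rule less.hyps) (use less.prems pos in auto)
      moreover have "sum ?z U = sum y U"
      proof -
        have U: "U = insert u (insert v (U - {u, v}))" using uv by auto
        have "sum f U = f u + f v + sum f (U - {u, v})" for f :: "'a \<Rightarrow> real"
          by (subst U) (use uv assms(1) in auto)
        moreover have "sum ?z (U - {u, v}) = sum y (U - {u, v})" by (intro sum.cong) auto
        ultimately show ?thesis using uv by simp
      qed
      moreover have "(\<Sum>K\<in>?C. \<Prod>i\<in>K. y i) \<le> (\<Sum>K\<in>?C. \<Prod>i\<in>K. ?z i)"
        using uv le less.prems assms(1) by (intro clique_polynomial_shift_mono) auto
      ultimately show ?thesis by simp
    qed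
    obtain u v where "u \<in> ?S" "v \<in> ?S" "u \<noteq> v" "{u, v} \<notin> E"
      using False by (auto simp: clique_def)
    moreover from this have "{v, u} \<notin> E" by (simp add: insert_commute)
    ultimately show ?thesis using step[of u v] step[of v u] linear by blast
  qed
qed

section \<open>Eigenvalues of the clique tensor\<close>

text \<open>
  The tensor is symmetric: each clique through \<open>i\<close> arises from \<open>(s - 1)!\<close> orderings of its other
  vertices, which cancels the entry \<open>1 / (s - 1)!\<close>. After this the tensor disappears from the
  argument and only sums over cliques remain.
\<close>

lemma sum_lists_eq_sum_cliques:
  fixes x :: "'a \<Rightarrow> complex"
  assumes "finite (verts G)" and "i \<in> verts G" and "0 < s"
  shows "(\<Sum>js | set js \<subseteq> verts G \<and> length js = s - 1.
            clique_tensor s G (i # js) * (\<Prod>j\<leftarrow>js. x j))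
       = (\<Sum>K | K \<in> cliques s G \<and> i \<in> K. \<Prod>j\<in>K-{i}. x j)"
proof -
  let ?C = "{K. K \<in> cliques s G \<and> i \<in> K}"
  let ?f = "\<lambda>js. clique_tensor s G (i # js) * (\<Prod>j\<leftarrow>js. x j)"
  let ?L = "{js. set js \<subseteq> verts G \<and> length js = s - 1}"
  have K: "finite K" "card K = s" "K \<subseteq> verts G" if "K \<in> cliques s G" for K
    using that by (auto simp: cliques_eq_cliques_on dest: cliques_onD)
  have finC: "finite ?C" using assms(1) by (simp add: cliques_eq_cliques_on)
  have "sum ?f ?L = sum ?f (\<Union>K\<in>?C. permutations_of_set (K - {i}))"
  proof (rule sum.mono_neutral_right)
    show "finite ?L" using assms(1) by (rule finite_lists_length_eq)
    show "(\<Union>K\<in>?C. permutations_of_set (K - {i})) \<subseteq> ?L"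
      using K(1,2) by (auto simp: permutations_of_set_def distinct_card[symmetric]) (use K(3) in blast)
    show "\<forall>js\<in>?L - (\<Union>K\<in>?C. permutations_of_set (K - {i})). ?f js = 0"
    proof
      fix js assume js: "js \<in> ?L - (\<Union>K\<in>?C. permutations_of_set (K - {i}))"
      have "set (i # js) \<notin> cliques s G"
      proof
        assume c: "set (i # js) \<in> cliques s G"
        have "card (set (i # js)) = length (i # js)" using K(2)[OF c] js assms(3) by simp
        then have "distinct (i # js)" by (rule card_distinct)
        then have "js \<in> permutations_of_set (set (i # js) - {i})"
          by (auto simp: permutations_of_set_def)
        then show False using js c by auto
      qed
      then show "?f js = 0" by (simp add: clique_tensor_def)
    qed
  qed
  also have "\<dots> = (\<Sum>K\<in>?C. sum ?f (permutations_of_set (K - {i})))"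
    using finC by (intro sum.UNION_disjoint) (auto dest: permutations_of_setD)
  also have "\<dots> = (\<Sum>K\<in>?C. \<Prod>j\<in>K-{i}. x j)"
  proof (rule sum.cong[OF refl])
    fix A assume A: "A \<in> ?C"
    have "?f js = (\<Prod>j\<in>A-{i}. x j) / fact (s - 1)" if "js \<in> permutations_of_set (A - {i})" for js
    proof -
      have js: "set js = A - {i}" "distinct js" using that by (auto simp: permutations_of_set_def)
      then have "set (i # js) = A" using A by auto
      then show ?thesis
        using A js prod.distinct_set_conv_list[OF js(2), of x] by (simp add: clique_tensor_def)
    qed
    moreover have "card (permutations_of_set (A - {i})) = fact (s - 1)"
      using A K[of A] by (subst card_permutations_of_set) auto
    ultimately show "sum ?f (permutations_of_set (A - {i})) = (\<Prod>j\<in>A-{i}. x j)" by simp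
  qed
  finally show ?thesis .
qed

definition clique_eigenpair :: "nat \<Rightarrow> 'a sgraph \<Rightarrow> complex \<Rightarrow> ('a \<Rightarrow> complex) \<Rightarrow> bool" where
  "clique_eigenpair s G l x \<longleftrightarrow>
     (\<forall>i\<in>verts G. (\<Sum>K | K \<in> cliques s G \<and> i \<in> K. \<Prod>j\<in>K-{i}. x j) = l * x i ^ (s - 1))"

lemma tensor_eigenvalue_clique_tensor:
  assumes "finite (verts G)" and "0 < s"
  shows "tensor_eigenvalue s (verts G) (clique_tensor s G) l \<longleftrightarrow>
           (\<exists>x. (\<exists>i\<in>verts G. x i \<noteq> 0) \<and> clique_eigenpair s G l x)"
  unfolding tensor_eigenvalue_def clique_eigenpair_def
  using sum_lists_eq_sum_cliques[OF assms(1) _ assms(2)] by (simp cong: ball_cong)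

text \<open>
  Multiply the \<open>i\<close>-th eigenvalue equation by \<open>x i\<close>, take moduli and sum over \<open>i\<close>: each clique is
  then counted once for each of its \<open>s\<close> vertices.
\<close>

lemma eigenvalue_bound:
  assumes "finite (verts G)" and "0 < s" and "clique_eigenpair s G l x"
  shows "cmod l * (\<Sum>i\<in>verts G. cmod (x i) ^ s)
     \<le> s * (\<Sum>K\<in>cliques s G. \<Prod>j\<in>K. cmod (x j))"
proof -
  let ?V = "verts G" let ?C = "cliques s G"
  have finC: "finite ?C" using assms(1) by (simp add: cliques_eq_cliques_on)
  have K: "finite K" "card K = s" "K \<subseteq> ?V" if "K \<in> ?C" for K
    using that by (auto simp: cliques_eq_cliques_on dest: cliques_onD)
  have "cmod l * cmod (x i) ^ s \<le> (\<Sum>K | K \<in> ?C \<and> i \<in> K. \<Prod>j\<in>K. cmod (x j))" if "i \<in> ?V" for i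
  proof -
    have "cmod l * cmod (x i) ^ s = cmod (x i) * cmod (l * x i ^ (s - 1))"
      using assms(2) by (cases s) (simp_all add: norm_mult norm_power)
    also have "l * x i ^ (s - 1) = (\<Sum>K | K \<in> ?C \<and> i \<in> K. \<Prod>j\<in>K-{i}. x j)"
      using assms(3) that by (simp add: clique_eigenpair_def)
    also have "cmod (x i) * cmod \<dots> \<le> cmod (x i) * (\<Sum>K | K \<in> ?C \<and> i \<in> K. \<Prod>j\<in>K-{i}. cmod (x j))"
      by (intro mult_left_mono order_trans[OF norm_sum] sum_mono) (auto simp: prod_norm)
    also have "\<dots> = (\<Sum>K | K \<in> ?C \<and> i \<in> K. \<Prod>j\<in>K. cmod (x j))"
      unfolding sum_distrib_left using K(1)
      by (intro sum.cong refl prod.remove[symmetric]) auto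
    finally show ?thesis .
  qed
  then have "cmod l * (\<Sum>i\<in>?V. cmod (x i) ^ s)
      \<le> (\<Sum>i\<in>?V. \<Sum>K | K \<in> ?C \<and> i \<in> K. \<Prod>j\<in>K. cmod (x j))"
    unfolding sum_distrib_left by (rule sum_mono)
  also have "\<dots> = (\<Sum>K\<in>?C. \<Sum>i | i \<in> ?V \<and> i \<in> K. \<Prod>j\<in>K. cmod (x j))"
    using sum.swap_restrict[OF assms(1) finC, of "\<lambda>i K. \<Prod>j\<in>K. cmod (x j)" "\<lambda>i K. i \<in> K"] by simp
  also have "\<dots> = (\<Sum>K\<in>?C. s * (\<Prod>j\<in>K. cmod (x j)))"
  proof (rule sum.cong[OF refl])
    fix K assume "K \<in> ?C"
    then have "{i. i \<in> ?V \<and> i \<in> K} = K" using K by auto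
    then show "(\<Sum>i | i \<in> ?V \<and> i \<in> K. \<Prod>j\<in>K. cmod (x j)) = s * (\<Prod>j\<in>K. cmod (x j))"
      using K(2)[OF \<open>K \<in> ?C\<close>] by simp
  qed
  finally show ?thesis by (simp add: sum_distrib_left)
qed

text \<open>
  Both bounds estimate the right-hand side of \<open>eigenvalue_bound\<close>. The first applies the inequality
  of means to each clique separately, which is wasteful but holds in every graph. The second uses convexity over the cliques and then the Motzkin--Straus inequality; complete
  \<open>s\<close>-partite graphs attain it.
\<close>

lemma
  assumes "finite (verts G)" and "0 < s" and "clique_eigenpair s G l x" and "\<exists>i\<in>verts G. x i \<noteq> 0"
  shows eigenvalue_le_card_cliques: "cmod l \<le> card (cliques s G)"
    and eigenvalue_power_le_card_cliques:
      "cliques (Suc s) G = {} \<Longrightarrow> cmod l ^ s \<le> real (card (cliques s G)) ^ (s - 1)"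
proof -
  let ?V = "verts G" let ?C = "cliques s G"
  let ?Y = "\<Sum>i\<in>?V. cmod (x i) ^ s"
  let ?F = "\<Sum>K\<in>?C. \<Prod>j\<in>K. cmod (x j)"
  have finC: "finite ?C" using assms(1) by (simp add: cliques_eq_cliques_on)
  have K: "finite K" "card K = s" "K \<subseteq> ?V" if "K \<in> ?C" for K
    using that by (auto simp: cliques_eq_cliques_on dest: cliques_onD)
  have Y: "?Y > 0"
    using assms(1,4) by (auto intro!: sum_pos2[OF assms(1)])
  have le: "cmod l * ?Y \<le> s * ?F" by (rule eigenvalue_bound[OF assms(1-3)])
  have "s * ?F = (\<Sum>K\<in>?C. s * (\<Prod>j\<in>K. cmod (x j)))" by (simp add: sum_distrib_left)
  also have "\<dots> \<le> (\<Sum>K\<in>?C. ?Y)"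
  proof (rule sum_mono)
    fix A assume A: "A \<in> ?C"
    have "s * (\<Prod>j\<in>A. cmod (x j)) \<le> (\<Sum>j\<in>A. cmod (x j) ^ s)"
      using card_times_prod_le_sum_power[of A "\<lambda>j. cmod (x j)"] K[OF A] assms(2) by fastforce
    also have "\<dots> \<le> ?Y" using K[OF A] assms(1) by (intro sum_mono2) auto
    finally show "s * (\<Prod>j\<in>A. cmod (x j)) \<le> ?Y" .
  qed
  finally have "cmod l * ?Y \<le> card ?C * ?Y" using le by simp
  then show "cmod l \<le> card ?C" using Y by simp
  assume free: "cliques (Suc s) G = {}"
  have F0: "?F \<ge> 0" by (intro sum_nonneg prod_nonneg) auto
  have "(cmod l * ?Y) ^ s \<le> (s * ?F) ^ s"
    by (rule power_mono[OF le]) (use Y in auto)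
  also have "\<dots> = real s ^ s * ?F ^ s" by (rule power_mult_distrib)
  also have "\<dots> \<le> real s ^ s * (real (card ?C) ^ (s - 1) * (\<Sum>K\<in>?C. (\<Prod>j\<in>K. cmod (x j)) ^ s))"
    by (intro mult_left_mono power_of_sum_le finC assms(2)) (auto intro: prod_nonneg)
  also have "(\<Sum>K\<in>?C. (\<Prod>j\<in>K. cmod (x j)) ^ s) = (\<Sum>K\<in>?C. \<Prod>j\<in>K. cmod (x j) ^ s)"
    by (simp add: prod_power_distrib)
  also have "\<dots> \<le> (?Y / s) ^ s"
    using clique_polynomial_le[OF assms(1,2), of "edges G" "\<lambda>i. cmod (x i) ^ s"] free
    by (simp add: cliques_eq_cliques_on)
  finally have "(cmod l * ?Y) ^ s \<le> real s ^ s * (real (card ?C) ^ (s - 1) * (?Y / s) ^ s)"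
    by (simp add: mult_left_mono)
  then have "cmod l ^ s * ?Y ^ s \<le> real (card ?C) ^ (s - 1) * ?Y ^ s"
    using assms(2) by (simp add: power_mult_distrib power_divide)
  then show "cmod l ^ s \<le> real (card ?C) ^ (s - 1)" using Y by simp
qed

lemma compact_cube: "compact {x :: 'a \<Rightarrow> complex. (\<forall>i\<in>V. cmod (x i) \<le> 1) \<and> (\<forall>i. i \<notin> V \<longrightarrow> x i = 0)}"
proof -
  let ?B = "\<lambda>i. if i \<in> V then cball 0 1 else {0 :: complex}"
  have "compactin (product_topology (\<lambda>i. euclidean) UNIV) (PiE UNIV ?B)"
    unfolding compactin_PiE by (auto simp: compactin_euclidean_iff)
  moreover have "PiE UNIV ?B = {x. (\<forall>i\<in>V. cmod (x i) \<le> 1) \<and> (\<forall>i. i \<notin> V \<longrightarrow> x i = 0)}"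
    by (auto simp: PiE_def Pi_def split: if_splits) 
  ultimately show ?thesis by (simp add: euclidean_product_topology)
qed

text \<open>
  Homogeneity of the eigenvalue equations; it allows eigenvectors to be normalised.
\<close>

lemma clique_eigenpair_scale:
  assumes "finite (verts G)" and "0 < s" and "clique_eigenpair s G l x"
  shows "clique_eigenpair s G l (\<lambda>i. c * x i)"
  unfolding clique_eigenpair_def
proof
  fix i assume i: "i \<in> verts G"
  have K: "finite K" "card K = s" if "K \<in> cliques s G" for K
    using that by (auto simp: cliques_eq_cliques_on dest: cliques_onD)
  have "(\<Sum>K | K \<in> cliques s G \<and> i \<in> K. \<Prod>j\<in>K-{i}. c * x j)
      = (\<Sum>K | K \<in> cliques s G \<and> i \<in> K. c ^ (s - 1) * (\<Prod>j\<in>K-{i}. x j))"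
    using K by (intro sum.cong refl) (auto simp: prod.distrib)
  also have "\<dots> = c ^ (s - 1) * (l * x i ^ (s - 1))"
    using assms(3) i by (simp add: clique_eigenpair_def sum_distrib_left[symmetric])
  finally show "(\<Sum>K | K \<in> cliques s G \<and> i \<in> K. \<Prod>j\<in>K-{i}. c * x j) = l * (c * x i) ^ (s - 1)"
    by (simp add: power_mult_distrib)
qed

text \<open>
  The spectral radius is defined as a greatest element, so it has to be shown that one exists.
  The pairs of an eigenvalue and a normalised eigenvector form a closed subset of a compact set,
  and there is at least one: for \<open>s \<ge> 3\<close> the unit vectors belong to the eigenvalue \<open>0\<close>.
\<close>

lemma eigenvalue_maximum_exists:
  assumes "finite (verts G)" and "verts G \<noteq> {}" and "3 \<le> s"
  shows "\<exists>l x. (\<exists>i\<in>verts G. x i \<noteq> 0) \<and> clique_eigenpair s G l x \<and>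
           (\<forall>l' x'. (\<exists>i\<in>verts G. x' i \<noteq> 0) \<longrightarrow> clique_eigenpair s G l' x' \<longrightarrow> cmod l' \<le> cmod l)"
proof -
  let ?V = "verts G" let ?C = "cliques s G"
  have s: "0 < s" using assms(3) by simp
  have K: "finite K" "card K = s" if "K \<in> ?C" for K
    using that by (auto simp: cliques_eq_cliques_on dest: cliques_onD)
  define X where "X = {x :: 'a \<Rightarrow> complex. (\<forall>i\<in>?V. cmod (x i) \<le> 1) \<and> (\<forall>i. i \<notin> ?V \<longrightarrow> x i = 0)}"
  define D where "D = cball (0::complex) (card ?C) \<times> X"
  define P where "P = D \<inter> {p. (\<Sum>i\<in>?V. cmod (snd p i) ^ s) = 1}
     \<inter> (\<Inter>i\<in>?V. {p. (\<Sum>K | K \<in> ?C \<and> i \<in> K. \<Prod>j\<in>K-{i}. snd p j) = fst p * snd p i ^ (s - 1)})"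
  have "compact D" unfolding D_def X_def by (intro compact_Times compact_cball compact_cube)
  have coord: "continuous_on UNIV (\<lambda>p :: complex \<times> ('a \<Rightarrow> complex). snd p j)" for j
    by (rule continuous_on_product_then_coordinatewise) (intro continuous_intros)
  have "closed {p :: complex \<times> ('a \<Rightarrow> complex). (\<Sum>i\<in>?V. cmod (snd p i) ^ s) = 1}"
    by (intro closed_Collect_eq continuous_intros coord)
  moreover have "closed (\<Inter>i\<in>?V. {p :: complex \<times> ('a \<Rightarrow> complex). (\<Sum>K | K \<in> ?C \<and> i \<in> K. \<Prod>j\<in>K-{i}. snd p j)
      = fst p * snd p i ^ (s - 1)})"
    by (intro closed_INT ballI closed_Collect_eq continuous_intros coord)
  ultimately have "compact P"
    unfolding P_def using \<open>compact D\<close> by (intro compact_Int_closed) auto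
  have norm_in_P: "\<exists>p\<in>P. fst p = l"
    if x: "\<exists>i\<in>?V. x i \<noteq> 0" "clique_eigenpair s G l x" for l x
  proof -
    let ?Y = "\<Sum>i\<in>?V. cmod (x i) ^ s"
    have Y: "?Y > 0" using assms(1) x by (auto intro!: sum_pos2[OF assms(1)])
    (* Outside the vertex set an eigenvector is unconstrained; it is set to zero there so that
       the normalised vectors lie in a compact set. *)
    define c where "c = 1 / root s ?Y"
    have c: "c > 0" "c ^ s * ?Y = 1" using Y s by (auto simp: c_def power_divide)
    define z where "z i = (if i \<in> ?V then c * x i else 0)" for i
    have "(\<Sum>i\<in>?V. cmod (z i) ^ s) = (\<Sum>i\<in>?V. c ^ s * cmod (x i) ^ s)"
      using c by (intro sum.cong) (auto simp: z_def norm_mult power_mult_distrib)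
    then have z1: "(\<Sum>i\<in>?V. cmod (z i) ^ s) = 1" using c by (simp add: sum_distrib_left[symmetric])
    have "cmod (z i) \<le> 1" if "i \<in> ?V" for i
    proof -
      have "cmod (z i) ^ s \<le> (\<Sum>i\<in>?V. cmod (z i) ^ s)"
        using that assms(1) by (intro member_le_sum) auto
      then show ?thesis using z1 s by (simp add: power_le_one_iff)
    qed
    then have "z \<in> X" by (auto simp: X_def z_def)
    moreover have "cmod l \<le> card ?C" by (rule eigenvalue_le_card_cliques[OF assms(1) s x(2,1)])
    moreover have "(\<Sum>K | K \<in> ?C \<and> i \<in> K. \<Prod>j\<in>K-{i}. z j) = l * z i ^ (s - 1)" if "i \<in> ?V" for i
    proof -
      have "(\<Sum>K | K \<in> ?C \<and> i \<in> K. \<Prod>j\<in>K-{i}. z j)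
          = (\<Sum>K | K \<in> ?C \<and> i \<in> K. \<Prod>j\<in>K-{i}. c * x j)"
        by (intro sum.cong prod.cong refl) (auto simp: z_def cliques_eq_cliques_on dest: cliques_onD)
      also have "\<dots> = l * (c * x i) ^ (s - 1)"
        using clique_eigenpair_scale[OF assms(1) s x(2), of "of_real c"] that by (simp add: clique_eigenpair_def)
      finally show ?thesis using that by (simp add: z_def)
    qed
    ultimately have "(l, z) \<in> P" using z1 by (auto simp: P_def D_def)
    then show ?thesis by force
  qed
  obtain v where v: "v \<in> ?V" using assms(2) by auto
  have "clique_eigenpair s G 0 (\<lambda>i. if i = v then 1 else 0)"
    unfolding clique_eigenpair_def
  proof (intro ballI)
    fix i assume "i \<in> ?V"
    have "(\<Prod>j\<in>A-{i}. if j = v then 1 else 0 :: complex) = 0" if "A \<in> ?C" "i \<in> A" for A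
    proof -
      have "card (A - {i}) \<ge> 2" using K[OF that(1)] that(2) assms(3) by simp
      moreover have "card (A - {i}) \<le> 1" if "A - {i} \<subseteq> {v}"
        using card_mono[OF _ that] by simp
      ultimately have "\<not> A - {i} \<subseteq> {v}" by fastforce
      then show ?thesis using K[OF that(1)] by (intro prod_zero) auto
    qed
    then show "(\<Sum>K | K \<in> ?C \<and> i \<in> K. \<Prod>j\<in>K-{i}. if j = v then 1 else 0 :: complex)
        = 0 * (if i = v then 1 else 0) ^ (s - 1)" by simp
  qed
  moreover have "\<exists>i\<in>?V. (if i = v then 1 else 0 :: complex) \<noteq> 0" using v by auto
  ultimately have "P \<noteq> {}" using norm_in_P[of "\<lambda>i. if i = v then 1 else 0" 0] by auto
  have "continuous_on P (\<lambda>p. cmod (fst p))" by (intro continuous_intros)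
  from continuous_attains_sup[OF \<open>compact P\<close> \<open>P \<noteq> {}\<close> this]
  obtain p where p: "p \<in> P" "\<forall>q\<in>P. cmod (fst q) \<le> cmod (fst p)" by blast
  have "clique_eigenpair s G (fst p) (snd p)" using p(1) by (auto simp: P_def clique_eigenpair_def)
  moreover have "\<exists>i\<in>?V. snd p i \<noteq> 0"
  proof (rule ccontr)
    assume "\<not> (\<exists>i\<in>?V. snd p i \<noteq> 0)"
    then have "(\<Sum>i\<in>?V. cmod (snd p i) ^ s) = 0" using s by (intro sum.neutral) auto
    then show False using p(1) by (simp add: P_def)
  qed
  moreover have "cmod l' \<le> cmod (fst p)"
    if "\<exists>i\<in>?V. x' i \<noteq> 0" "clique_eigenpair s G l' x'" for l' x'
    using norm_in_P[OF that] p(2) by blast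
  ultimately show ?thesis by blast
qed

lemma clique_spectral_radius_eigenvalue:
  assumes "finite (verts G)" and "verts G \<noteq> {}" and "3 \<le> s"
  obtains l x where "\<exists>i\<in>verts G. x i \<noteq> 0" "clique_eigenpair s G l x"
    "clique_spectral_radius s G = cmod l"
  and "\<And>l' x'. \<exists>i\<in>verts G. x' i \<noteq> 0 \<Longrightarrow> clique_eigenpair s G l' x' \<Longrightarrow>
         cmod l' \<le> clique_spectral_radius s G"
proof -
  obtain l x where lx: "\<exists>i\<in>verts G. x i \<noteq> 0" "clique_eigenpair s G l x"
    "\<And>l' x'. \<exists>i\<in>verts G. x' i \<noteq> 0 \<Longrightarrow> clique_eigenpair s G l' x' \<Longrightarrow> cmod l' \<le> cmod l"
    using eigenvalue_maximum_exists[OF assms] by metis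
  have "clique_spectral_radius s G = cmod l"
    unfolding clique_spectral_radius_def tensor_spectral_radius_def
  proof (rule Greatest_equality)
    have "tensor_eigenvalue s (verts G) (clique_tensor s G) l"
      using lx(1,2) assms(3) by (subst tensor_eigenvalue_clique_tensor[OF assms(1)]) auto
    then show "\<exists>l'. tensor_eigenvalue s (verts G) (clique_tensor s G) l' \<and> cmod l = cmod l'" by blast
    show "y \<le> cmod l" if "\<exists>l'. tensor_eigenvalue s (verts G) (clique_tensor s G) l' \<and> y = cmod l'" for y
      using that lx(3) assms(3) by (auto simp: tensor_eigenvalue_clique_tensor[OF assms(1)])
  qed
  then show ?thesis using lx that by metis
qed

text \<open>
  These four facts are all that the combinatorial part uses about the spectral radius.
\<close>

lemma
  assumes "finite (verts G)" and "verts G \<noteq> {}" and "3 \<le> s"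
  shows clique_spectral_radius_nonneg: "0 \<le> clique_spectral_radius s G"
    and clique_spectral_radius_le_card: "clique_spectral_radius s G \<le> card (cliques s G)"
    and clique_spectral_radius_power_le:
      "cliques (Suc s) G = {} \<Longrightarrow> clique_spectral_radius s G ^ s \<le> real (card (cliques s G)) ^ (s - 1)"
    and clique_spectral_radius_ge: "\<exists>i\<in>verts G. x i \<noteq> 0 \<Longrightarrow> clique_eigenpair s G l x \<Longrightarrow>
         cmod l \<le> clique_spectral_radius s G"
proof -
  have s: "0 < s" using assms(3) by simp
  obtain l x where lx: "\<exists>i\<in>verts G. x i \<noteq> 0" "clique_eigenpair s G l x"
    "clique_spectral_radius s G = cmod l"
    using clique_spectral_radius_eigenvalue[OF assms] by metis
  show "0 \<le> clique_spectral_radius s G" using lx(3) by simp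
  show "clique_spectral_radius s G \<le> card (cliques s G)"
    using eigenvalue_le_card_cliques[OF assms(1) s lx(2,1)] lx(3) by simp
  show "clique_spectral_radius s G ^ s \<le> real (card (cliques s G)) ^ (s - 1)"
    if "cliques (Suc s) G = {}"
    using eigenvalue_power_le_card_cliques[OF assms(1) s lx(2,1) that] lx(3) by simp
  show "cmod l \<le> clique_spectral_radius s G" if "\<exists>i\<in>verts G. x i \<noteq> 0" "clique_eigenpair s G l x" for l x
    using clique_spectral_radius_eigenvalue[OF assms] that by metis
qed

section \<open>Complete multipartite graphs\<close>

definition complete_multipartite :: "'a set \<Rightarrow> 'a set set \<Rightarrow> nat \<Rightarrow> ('a \<Rightarrow> nat) \<Rightarrow> bool" where
  "complete_multipartite U E k c \<longleftrightarrow>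
     (\<forall>u\<in>U. c u < k) \<and> (\<forall>u\<in>U. \<forall>v\<in>U. {u, v} \<in> E \<longleftrightarrow> c u \<noteq> c v)"

abbreviation colour_class :: "'a set \<Rightarrow> ('a \<Rightarrow> nat) \<Rightarrow> nat \<Rightarrow> 'a set" where
  "colour_class U c i \<equiv> {u\<in>U. c u = i}"

text \<open>
  Expanding the product of the class sums picks one vertex from each class, that is, a transversal.
\<close>

lemma sum_transversals:
  fixes y :: "'a \<Rightarrow> 'b :: comm_semiring_1"
  assumes "finite U" and "finite I"
  shows "(\<Sum>S | S \<subseteq> U \<and> inj_on c S \<and> c ` S = I. \<Prod>u\<in>S. y u)
       = (\<Prod>i\<in>I. \<Sum>u\<in>colour_class U c i. y u)"
proof -
  have "(\<Prod>i\<in>I. \<Sum>u\<in>colour_class U c i. y u)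
      = (\<Sum>g\<in>PiE I (colour_class U c). \<Prod>i\<in>I. y (g i))"
    using assms by (intro prod_sum_PiE) auto
  also have "\<dots> = (\<Sum>S | S \<subseteq> U \<and> inj_on c S \<and> c ` S = I. \<Prod>u\<in>S. y u)"
  proof (rule sum.reindex_bij_witness[of _ "\<lambda>S. \<lambda>i\<in>I. inv_into S c i" "\<lambda>g. g ` I"])
    fix g assume g: "g \<in> PiE I (colour_class U c)"
    then have cg: "c (g i) = i" "g i \<in> U" if "i \<in> I" for i using that by (auto simp: PiE_def Pi_def)
    have inj: "inj_on c (g ` I)" using cg by (auto simp: inj_on_def)
    show "(\<lambda>i\<in>I. inv_into (g ` I) c i) = g"
    proof
      fix i show "(\<lambda>i\<in>I. inv_into (g ` I) c i) i = g i"
      proof (cases "i \<in> I")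
        case True
        then have "inv_into (g ` I) c (c (g i)) = g i" by (intro inv_into_f_f inj) auto
        then show ?thesis using True cg by simp
      next
        case False then show ?thesis using g by (auto simp: PiE_def extensional_def)
      qed
    qed
    show "g ` I \<in> {S. S \<subseteq> U \<and> inj_on c S \<and> c ` S = I}"
      using cg inj by (auto simp: image_iff)
    have "inj_on g I" using cg(1) by (auto intro: inj_on_inverseI)
    then show "(\<Prod>u\<in>g ` I. y u) = (\<Prod>i\<in>I. y (g i))" by (simp add: prod.reindex)
  next
    fix S assume S: "S \<in> {S. S \<subseteq> U \<and> inj_on c S \<and> c ` S = I}"
    show "(\<lambda>i\<in>I. inv_into S c i) ` I = S"
    proof -
      have "(\<lambda>i\<in>I. inv_into S c i) ` I = inv_into S c ` (c ` S)" using S by auto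
      also have "\<dots> = S" using S by (intro inv_into_image_cancel) auto
      finally show ?thesis .
    qed
    show "(\<lambda>i\<in>I. inv_into S c i) \<in> PiE I (colour_class U c)"
    proof (rule PiE_I)
      fix i assume "i \<in> I"
      then have "i \<in> c ` S" using S by simp
      then have "inv_into S c i \<in> S" "c (inv_into S c i) = i" by (auto intro: inv_into_into f_inv_into_f)
      then show "(\<lambda>i\<in>I. inv_into S c i) i \<in> colour_class U c i" using S \<open>i \<in> I\<close> by auto
    qed auto
  qed
  finally show ?thesis by simp
qed

lemma multipartite_cliques:
  assumes "finite U" and "complete_multipartite U E k c"
  shows "cliques_on k U E = {S. S \<subseteq> U \<and> inj_on c S \<and> c ` S = {..<k}}"
proof (intro equalityI subsetI)
  fix K assume "K \<in> cliques_on k U E"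
  then have K: "K \<subseteq> U" "finite K" "card K = k" "clique K E" by (rule cliques_onD)+
  have inj: "inj_on c K"
  proof (rule inj_onI, rule ccontr)
    fix u v assume uv: "u \<in> K" "v \<in> K" "c u = c v" "u \<noteq> v"
    then have "{u, v} \<in> E" using K(4) by (simp add: clique_def)
    moreover have "u \<in> U" "v \<in> U" using uv K(1) by auto
    ultimately show False using assms(2) uv(3) by (simp add: complete_multipartite_def)
  qed
  have "c ` K \<subseteq> {..<k}" using K assms(2) by (auto simp: complete_multipartite_def)
  then have "c ` K = {..<k}"
    using inj K by (intro card_subset_eq) (auto simp: card_image)
  then show "K \<in> {S. S \<subseteq> U \<and> inj_on c S \<and> c ` S = {..<k}}" using K inj by auto
next
  fix S assume "S \<in> {S. S \<subseteq> U \<and> inj_on c S \<and> c ` S = {..<k}}"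
  then have S: "S \<subseteq> U" "inj_on c S" "c ` S = {..<k}" by auto
  have "card S = k" using card_image[OF S(2)] S(3) by simp
  moreover have "clique S E"
    unfolding clique_def
  proof (intro ballI impI)
    fix u v assume uv: "u \<in> S" "v \<in> S" "u \<noteq> v"
    then have "c u \<noteq> c v" using S(2) by (auto dest: inj_onD)
    moreover have "u \<in> U" "v \<in> U" using uv S(1) by auto
    ultimately show "{u, v} \<in> E" using assms(2) by (simp add: complete_multipartite_def)
  qed
  ultimately show "S \<in> cliques_on k U E"
    using S finite_subset[OF S(1) assms(1)] by (simp add: cliques_on_def)
qed

lemma card_multipartite_cliques:
  assumes "finite U" and "complete_multipartite U E k c"
  shows "card (cliques_on k U E) = (\<Prod>i<k. card (colour_class U c i))"
  using sum_transversals[OF assms(1), where c = c and I = "{..<k}" and y = "\<lambda>_. 1 :: nat"]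
  by (simp add: multipartite_cliques[OF assms])

lemma multipartite_no_larger_cliques:
  assumes "finite U" and "complete_multipartite U E k c" and "k < p"
  shows "cliques_on p U E = {}"
proof (rule ccontr)
  assume "cliques_on p U E \<noteq> {}"
  then obtain K where "K \<in> cliques_on p U E" by auto
  then have K: "K \<subseteq> U" "finite K" "card K = p" "clique K E" by (rule cliques_onD)+
  have "inj_on c K"
  proof (rule inj_onI, rule ccontr)
    fix u v assume uv: "u \<in> K" "v \<in> K" "c u = c v" "u \<noteq> v"
    then have "{u, v} \<in> E" using K(4) by (simp add: clique_def)
    moreover have "u \<in> U" "v \<in> U" using uv K(1) by auto
    ultimately show False using assms(2) uv(3) by (simp add: complete_multipartite_def)
  qed
  moreover have "c ` K \<subseteq> {..<k}" using K assms(2) by (auto simp: complete_multipartite_def)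
  ultimately have "card K \<le> card {..<k}" by (rule card_inj_on_le) simp
  then have "p \<le> k" using K(3) by simp
  then show False using assms(3) by simp
qed

lemma multipartite_clique_through:
  assumes "finite U" and "complete_multipartite U E k c"
    and ne: "\<And>i. i < k \<Longrightarrow> colour_class U c i \<noteq> {}" and "w \<in> U"
  shows "\<exists>Q\<in>cliques_on k U E. w \<in> Q"
proof -
  have "\<forall>i\<in>{..<k}. \<exists>u. u \<in> colour_class U c i" using ne by blast
  from bchoice[OF this] obtain g where g: "\<And>i. i < k \<Longrightarrow> g i \<in> colour_class U c i" by blast
  define f where "f = g(c w := w)"
  have f: "f i \<in> U" "c (f i) = i" if "i < k" for i
    using g[OF that] assms(4) by (auto simp: f_def)
  have "c w < k" using assms(2,4) by (simp add: complete_multipartite_def)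
  moreover have "f (c w) = w" by (simp add: f_def)
  ultimately have "w \<in> f ` {..<k}" by (intro image_eqI[of _ _ "c w"]) auto
  moreover have "f ` {..<k} \<in> cliques_on k U E"
  proof -
    have "f ` {..<k} \<subseteq> U" using f(1) by auto
    moreover have "inj_on c (f ` {..<k})" using f(2) by (simp add: inj_on_def)
    moreover have "c ` f ` {..<k} = {..<k}" using f(2) by (auto simp: image_image)
    ultimately show ?thesis unfolding multipartite_cliques[OF assms(1,2)] by blast
  qed
  ultimately show ?thesis by (rule bexI)
qed

text \<open>
  The vector with value \<open>n\<^sub>i powr (-1/k)\<close> on the \<open>i\<close>-th class, where \<open>n\<^sub>i\<close> is the size of the class,
  and \<open>0\<close> outside \<open>U\<close> is an eigenvector. Cliques outside \<open>U\<close> would spoil the equations, so all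
  \<open>k\<close>-cliques are required to lie in \<open>U\<close>. Apart from the complete multipartite graphs themselves
  this covers a graph whose only \<open>k\<close>-clique is \<open>U\<close>.
\<close>

lemma clique_spectral_radius_multipartite_ge:
  assumes "finite (verts G)" and "3 \<le> k" and "U \<subseteq> verts G"
    and mp: "complete_multipartite U (edges G) k c"
    and ne: "\<And>i. i < k \<Longrightarrow> colour_class U c i \<noteq> {}"
    and inU: "\<And>K. K \<in> cliques k G \<Longrightarrow> K \<subseteq> U"
  shows "(\<Prod>i<k. real (card (colour_class U c i))) ^ (k - 1) \<le> clique_spectral_radius k G ^ k"
proof -
  let ?E = "edges G"
  have finU: "finite U" using assms(1,3) by (rule finite_subset[rotated])
  have k: "0 < k" using assms(2) by simp
  define n where "n i = real (card (colour_class U c i))" for i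
  have npos: "n i > 0" if "i < k" for i
    using ne[OF that] finU by (auto simp: n_def card_gt_0_iff)
  define w where "w i = root k (1 / n i)" for i
  have w: "w i > 0" "w i ^ k = 1 / n i" if "i < k" for i
    using npos[OF that] k by (auto simp: w_def)
  define x where "x u = (if u \<in> U then complex_of_real (w (c u)) else 0)" for u
  define l where "l = (\<Prod>i<k. n i * w i)"
  have C: "cliques k G = cliques_on k U ?E"
    using inU assms(3) by (auto simp: cliques_eq_cliques_on cliques_on_def)
  have class_sum: "(\<Sum>u\<in>colour_class U c i. x u) = n i * w i" for i
    by (simp add: x_def n_def)
  have "clique_eigenpair k G l x"
    unfolding clique_eigenpair_def
  proof
    fix v assume "v \<in> verts G"
    show "(\<Sum>K | K \<in> cliques k G \<and> v \<in> K. \<Prod>j\<in>K-{v}. x j) = l * x v ^ (k - 1)"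
    proof (cases "v \<in> U")
      case False
      then have "{K. K \<in> cliques k G \<and> v \<in> K} = {}" using inU by auto
      then have "(\<Sum>K | K \<in> cliques k G \<and> v \<in> K. \<Prod>j\<in>K-{v}. x j) = 0" by (simp only: sum.empty)
      then show ?thesis using False assms(2) by (simp add: x_def zero_power)
    next
      case True
      let ?I = "{..<k} - {c v}"
      have cv: "c v < k" using mp True by (simp add: complete_multipartite_def)
      have "(\<Sum>K | K \<in> cliques k G \<and> v \<in> K. \<Prod>j\<in>K-{v}. x j)
          = (\<Sum>S | S \<subseteq> U \<and> inj_on c S \<and> c ` S = ?I. \<Prod>u\<in>S. x u)"
      proof (rule sum.reindex_bij_witness[of _ "insert v" "\<lambda>K. K - {v}"])
        fix K assume "K \<in> {K. K \<in> cliques k G \<and> v \<in> K}"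
        then have K: "K \<subseteq> U" "inj_on c K" "c ` K = {..<k}" "v \<in> K"
          by (auto simp: C multipartite_cliques[OF finU mp])
        show "insert v (K - {v}) = K" using K by auto
        have "c ` (K - {v}) = ?I"
          using K by (subst inj_on_image_set_diff[OF K(2)]) auto
        then show "K - {v} \<in> {S. S \<subseteq> U \<and> inj_on c S \<and> c ` S = ?I}"
          using K by (auto intro: inj_on_subset)
      next
        fix S assume "S \<in> {S. S \<subseteq> U \<and> inj_on c S \<and> c ` S = ?I}"
        then have S: "S \<subseteq> U" "inj_on c S" "c ` S = ?I" by auto
        then have "v \<notin> S" by auto
        then show "insert v S - {v} = S" by simp
        have "insert v S \<subseteq> U" "inj_on c (insert v S)" "c ` (insert v S) = {..<k}"
          using S True cv \<open>v \<notin> S\<close> by auto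
        then show "insert v S \<in> {K. K \<in> cliques k G \<and> v \<in> K}"
          by (auto simp: C multipartite_cliques[OF finU mp])
      qed simp
      also have "\<dots> = (\<Prod>i\<in>?I. complex_of_real (n i * w i))"
        by (subst sum_transversals[OF finU]) (simp_all add: class_sum)
      also have "\<dots> = (\<Prod>i\<in>?I. complex_of_real (n i * w i)) * complex_of_real (n (c v) * w (c v) ^ k)"
        using w(2)[OF cv] npos[OF cv] by simp
      also have "w (c v) ^ k = w (c v) * w (c v) ^ (k - 1)" using k by (simp add: power_eq_if)
      also have "(\<Prod>i\<in>?I. complex_of_real (n i * w i)) * complex_of_real (n (c v) * (w (c v) * w (c v) ^ (k - 1)))
          = complex_of_real ((n (c v) * w (c v)) * (\<Prod>i\<in>?I. n i * w i)) * x v ^ (k - 1)"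
        using True by (simp add: x_def)
      also have "(n (c v) * w (c v)) * (\<Prod>i\<in>?I. n i * w i) = l"
        unfolding l_def using cv by (intro prod.remove[symmetric]) auto
      finally show ?thesis .
    qed
  qed
  moreover obtain u where "u \<in> colour_class U c 0" using ne[of 0] k by auto
  then have "\<exists>i\<in>verts G. x i \<noteq> 0"
    using assms(3) w(1)[of "c u"] k by (intro bexI[of _ u]) (auto simp: x_def)
  moreover have "verts G \<noteq> {}" using \<open>u \<in> colour_class U c 0\<close> assms(3) by auto
  ultimately have "cmod l \<le> clique_spectral_radius k G"
    using clique_spectral_radius_ge[OF assms(1) _ assms(2)] by blast
  moreover have "l \<ge> 0" unfolding l_def using npos w by (intro prod_nonneg) (auto simp: less_imp_le)
  ultimately have "l ^ k \<le> clique_spectral_radius k G ^ k" by (intro power_mono) auto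
  moreover have "l ^ k = (\<Prod>i<k. n i ^ (k - 1))"
    unfolding l_def prod_power_distrib
  proof (intro prod.cong refl)
    fix i assume "i \<in> {..<k}"
    then show "(n i * w i) ^ k = n i ^ (k - 1)"
      using w(2)[of i] npos[of i] k by (cases k) (auto simp: power_mult_distrib)
  qed
  ultimately show ?thesis by (simp add: prod_power_distrib n_def)
qed

lemma clique_spectral_radius_multipartite:
  assumes "finite (verts G)" and "3 \<le> k"
    and mp: "complete_multipartite (verts G) (edges G) k c"
    and ne: "\<And>i. i < k \<Longrightarrow> colour_class (verts G) c i \<noteq> {}"
  shows "clique_spectral_radius k G ^ k = (\<Prod>i<k. real (card (colour_class (verts G) c i))) ^ (k - 1)"
proof (rule antisym)
  have "verts G \<noteq> {}" using ne[of 0] assms(2) by auto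
  moreover have "cliques (Suc k) G = {}"
    using multipartite_no_larger_cliques[OF assms(1) mp] by (simp add: cliques_eq_cliques_on)
  ultimately show "clique_spectral_radius k G ^ k \<le> (\<Prod>i<k. real (card (colour_class (verts G) c i))) ^ (k - 1)"
    using clique_spectral_radius_power_le[OF assms(1) _ assms(2)] card_multipartite_cliques[OF assms(1) mp]
    by (simp add: cliques_eq_cliques_on)
  show "(\<Prod>i<k. real (card (colour_class (verts G) c i))) ^ (k - 1) \<le> clique_spectral_radius k G ^ k"
    by (rule clique_spectral_radius_multipartite_ge[OF assms(1,2) subset_refl mp ne])
       (auto simp: cliques_eq_cliques_on cliques_on_def)
qed

section \<open>The number of cliques without a larger clique\<close>

text \<open>
  Zykov's extension of Turan's theorem, with the equality case. In the induction step let \<open>v\<close> be a vertex in the largest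
  number of cliques of size \<open>s + 1\<close>. Its neighbourhood \<open>N\<close> contains no such clique, so every one of
  them uses a vertex of \<open>W = U - N\<close>, and their number is at most \<open>card W\<close> times that of the
  \<open>s\<close>-cliques in \<open>N\<close>; induction applies to \<open>N\<close>, and \<open>W\<close> becomes the new class. Under equality
  each clique meets \<open>W\<close> exactly once and each vertex of \<open>W\<close> extends every \<open>s\<close>-clique of \<open>N\<close>, which
  forces \<open>W\<close> to be independent and completely joined to \<open>N\<close>.
  
  The bound is stated through a colouring instead of the numerical maximum, since the induction
  produces the colour classes themselves.
\<close>

lemma zykov_clique_bound:
  assumes "finite U" and loopless: "\<And>u. {u} \<notin> E" and "0 < s" and "cliques_on (Suc s) U E = {}"
  shows "\<exists>c. (\<forall>u\<in>U. c u < s) \<and>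
           card (cliques_on s U E) \<le> (\<Prod>i<s. card (colour_class U c i)) \<and>
           (card (cliques_on s U E) = (\<Prod>i<s. card (colour_class U c i)) \<longrightarrow>
            0 < card (cliques_on s U E) \<longrightarrow> complete_multipartite U E s c)"
  using assms(3,1,4)
proof (induction s arbitrary: U rule: nat_induct_non_zero)
  case 1
  have "cliques_on 1 U E = (\<lambda>u. {u}) ` U"
    by (auto simp: cliques_on_def card_1_singleton_iff clique_def)
  then have card: "card (cliques_on 1 U E) = card U" by (simp add: card_image)
  have nonadj: "{u, v} \<notin> E" if "u \<in> U" "v \<in> U" for u v
  proof (cases "u = v")
    case True then show ?thesis using loopless by simp
  next
    case False
    show ?thesis
    proof
      assume "{u, v} \<in> E"
      then have "{u, v} \<in> cliques_on (Suc 1) U E"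
        using that False by (auto simp: cliques_on_def clique_def insert_commute)
      then show False using "1.prems" by simp
    qed
  qed
  show ?case
    using card nonadj by (intro exI[of _ "\<lambda>_. 0"]) (auto simp: complete_multipartite_def)
next
  case (Suc s)
  let ?C = "cliques_on (Suc s) U E"
  have finC: "finite ?C" using Suc.prems(1) by simp
  show ?case
  proof (cases "?C = {}")
    case True
    then show ?thesis by (intro exI[of _ "\<lambda>_. 0"]) auto
  next
    case False
    define d where "d u = card {K\<in>?C. u \<in> K}" for u
    define N where "N u = {w\<in>U. {u, w} \<in> E}" for u
    have "U \<noteq> {}" using False by (auto simp: cliques_on_def)
    then have "Max (d ` U) \<in> d ` U" using Suc.prems(1) by (intro Max_in) auto
    then obtain v where "v \<in> U" "d v = Max (d ` U)" by auto
    then have v: "v \<in> U" "\<And>u. u \<in> U \<Longrightarrow> d u \<le> d v" using Suc.prems(1) by auto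
    let ?N = "N v" and ?W = "U - N v"
    have NU: "?N \<subseteq> U" "finite ?N" using Suc.prems(1) by (auto simp: N_def)
    have vN: "v \<notin> ?N" using loopless by (simp add: N_def)
    have insert_v: "insert v Q \<in> cliques_on (Suc p) U E" if "Q \<in> cliques_on p ?N E" for Q p
    proof -
      have "v \<notin> Q" using that vN by (auto dest: cliques_onD)
      then show ?thesis
        using that v(1) by (auto simp: cliques_on_def clique_def N_def insert_commute)
    qed
    have free: "cliques_on (Suc s) ?N E = {}" using insert_v Suc.prems(2) by blast
    have remove: "K - {u} \<in> cliques_on s (N u) E" if "K \<in> ?C" "u \<in> K" for K u
      using that by (auto simp: cliques_on_def clique_def N_def)
    have inj_remove: "inj_on (\<lambda>K. K - {u}) {K\<in>?C. u \<in> K}" for u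
      by (rule inj_onI) auto
    have dv_le: "d v \<le> card (cliques_on s ?N E)"
      unfolding d_def
      by (rule card_inj_on_le[OF inj_remove]) (use remove NU in auto)
    from Suc.IH[OF NU(2) free] obtain c' where IH: "(\<forall>u\<in>?N. c' u < s) \<and>
        card (cliques_on s ?N E) \<le> (\<Prod>i<s. card (colour_class ?N c' i)) \<and>
        (card (cliques_on s ?N E) = (\<Prod>i<s. card (colour_class ?N c' i)) \<longrightarrow>
         0 < card (cliques_on s ?N E) \<longrightarrow> complete_multipartite ?N E s c')"
      by (elim exE)
    then have c': "\<forall>u\<in>?N. c' u < s"
      "card (cliques_on s ?N E) \<le> (\<Prod>i<s. card (colour_class ?N c' i))"
      "card (cliques_on s ?N E) = (\<Prod>i<s. card (colour_class ?N c' i)) \<Longrightarrow>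
            0 < card (cliques_on s ?N E) \<Longrightarrow> complete_multipartite ?N E s c'"
      by simp_all
    define c where "c u = (if u \<in> ?N then c' u else s)" for u
    have classN: "colour_class U c i = colour_class ?N c' i" if "i < s" for i
      using that NU by (auto simp: c_def split: if_splits)
    have classW: "colour_class U c s = ?W" using c'(1) by (auto simp: c_def split: if_splits)
    have prod_c: "(\<Prod>i<Suc s. card (colour_class U c i)) = (\<Prod>i<s. card (colour_class ?N c' i)) * card ?W"
      by (simp add: classN classW)
    have meets: "K \<inter> ?W \<noteq> {}" if "K \<in> ?C" for K
    proof
      assume "K \<inter> ?W = {}"
      then have "K \<in> cliques_on (Suc s) ?N E" using that by (auto simp: cliques_on_def)
      then show False using free by simp
    qed
    (* Each of the three estimates is kept under a name: equality in all of them is what the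
       second half of the proof exploits. *)
    have "card ?C = (\<Sum>K\<in>?C. 1)" by simp
    also have sum1: "\<dots> \<le> (\<Sum>K\<in>?C. card (K \<inter> ?W))"
      using meets Suc.prems(1) by (intro sum_mono) (simp add: Suc_le_eq card_gt_0_iff)
    also have sum2: "\<dots> = (\<Sum>u\<in>?W. d u)"
    proof -
      have "(\<Sum>u\<in>?W. \<Sum>K | K \<in> ?C \<and> u \<in> K. 1) = (\<Sum>K\<in>?C. \<Sum>u | u \<in> ?W \<and> u \<in> K. 1 :: nat)"
        by (rule sum.swap_restrict) (use finC Suc.prems(1) in auto)
      moreover have "{u. u \<in> ?W \<and> u \<in> K} = K \<inter> ?W" for K by auto
      ultimately show ?thesis by (simp add: d_def)
    qed
    also have sum3: "\<dots> \<le> card ?W * d v"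
      using v(2) sum_bounded_above[of ?W d "d v"] by simp
    finally have le: "card ?C \<le> card ?W * d v" .
    also have "\<dots> \<le> card ?W * card (cliques_on s ?N E)" using dv_le by simp
    also have "\<dots> \<le> card ?W * (\<Prod>i<s. card (colour_class ?N c' i))" using c'(2) by simp
    finally have bound: "card ?C \<le> (\<Prod>i<Suc s. card (colour_class U c i))"
      by (simp only: prod_c mult.commute)
    have "complete_multipartite U E (Suc s) c"
      if eq: "card ?C = (\<Prod>i<Suc s. card (colour_class U c i))" and pos: "0 < card ?C"
    proof -
      have Wpos: "card ?W > 0" "(\<Prod>i<s. card (colour_class ?N c' i)) > 0"
        using eq pos unfolding prod_c by auto
      have "card ?W * (\<Prod>i<s. card (colour_class ?N c' i)) \<le> card ?W * d v"
        using le eq prod_c by (simp add: mult.commute)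
      then have dv: "d v = (\<Prod>i<s. card (colour_class ?N c' i))"
        "d v = card (cliques_on s ?N E)"
        using Wpos dv_le c'(2) by auto
      have mpN: "complete_multipartite ?N E s c'" using c'(3) dv Wpos(2) by simp
      have sums: "(\<Sum>K\<in>?C. card (K \<inter> ?W)) = card ?C" "(\<Sum>u\<in>?W. d u) = card ?W * d v"
        using sum1 sum2 sum3 eq prod_c dv(1) by (auto simp: mult.commute)
      have single: "card (K \<inter> ?W) = 1" if "K \<in> ?C" for K
      proof (rule ccontr)
        assume ne1: "card (K \<inter> ?W) \<noteq> 1"
        have ge1: "1 \<le> card (L \<inter> ?W)" if "L \<in> ?C" for L
          using meets[OF that] Suc.prems(1) by (simp add: Suc_le_eq card_gt_0_iff)
        have "(\<Sum>K\<in>?C. 1) < (\<Sum>K\<in>?C. card (K \<inter> ?W))"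
        proof (rule sum_strict_mono_ex1[OF finC])
          show "\<exists>L\<in>?C. 1 < card (L \<inter> ?W)"
            using ne1 ge1[OF that] that by (intro bexI[of _ K]) auto
        qed (use ge1 in auto)
        then show False using sums(1) by simp
      qed
      have deg: "d u = d v" if "u \<in> ?W" for u
      proof (rule ccontr)
        assume "d u \<noteq> d v"
        then have "d u < d v" using v(2)[of u] that by simp
        then have "(\<Sum>u\<in>?W. d u) < (\<Sum>u\<in>?W. d v)"
          using v(2) that Suc.prems(1)
          by (intro sum_strict_mono_ex1 bexI[of _ u]) auto
        then show False using sums(2) by simp
      qed
      have extend: "insert u Q \<in> ?C" if u: "u \<in> ?W" and Q: "Q \<in> cliques_on s ?N E" for u Q
      proof -
        have "(\<lambda>K. K - {u}) ` {K\<in>?C. u \<in> K} \<subseteq> cliques_on s ?N E"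
        proof (rule image_subsetI)
          fix K assume K: "K \<in> {K\<in>?C. u \<in> K}"
          obtain a where "K \<inter> ?W = {a}" using single[of K] K by (auto simp: card_1_singleton_iff)
          moreover have "u \<in> K \<inter> ?W" using K u by simp
          moreover have "K \<subseteq> U" using K by (auto dest: cliques_onD)
          ultimately have "K - {u} \<subseteq> ?N" by auto
          moreover have "K - {u} \<in> cliques_on s (N u) E" using remove[of K u] K by simp
          ultimately show "K - {u} \<in> cliques_on s ?N E" by (simp add: cliques_on_def)
        qed
        moreover have "card ((\<lambda>K. K - {u}) ` {K\<in>?C. u \<in> K}) = card (cliques_on s ?N E)"
          using deg[OF u] dv(2) by (simp add: card_image[OF inj_remove] d_def)
        ultimately have "(\<lambda>K. K - {u}) ` {K\<in>?C. u \<in> K} = cliques_on s ?N E"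
          using NU(2) by (intro card_subset_eq) auto
        then obtain K where "K \<in> ?C" "u \<in> K" "Q = K - {u}" using Q by blast
        then show ?thesis by (simp add: insert_absorb)
      qed
      have NW: "{u, w} \<in> E" if u: "u \<in> ?W" and w: "w \<in> ?N" for u w
      proof -
        have "colour_class ?N c' i \<noteq> {}" if "i < s" for i
          using Wpos(2) that by (metis card.empty finite_lessThan lessThan_iff not_gr_zero prod_zero)
        then obtain Q where "Q \<in> cliques_on s ?N E" "w \<in> Q"
          using multipartite_clique_through[OF NU(2) mpN _ w] by blast
        then have "clique (insert u Q) E" "w \<in> Q" using extend[OF u] by (auto dest: cliques_onD)
        moreover have "u \<noteq> w" using u w by auto
        ultimately show ?thesis by (simp add: clique_def)
      qed
      have WW: "{u, w} \<notin> E" if u: "u \<in> ?W" and w: "w \<in> ?W" for u w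
      proof (cases "u = w")
        case True then show ?thesis using loopless by simp
      next
        case False
        have "cliques_on s ?N E \<noteq> {}" using dv Wpos by force
        then obtain Q where Q: "Q \<in> cliques_on s ?N E" by auto
        then have ins: "insert u Q \<in> ?C" "insert w Q \<in> ?C" using extend u w by auto
        have QN: "Q \<subseteq> ?N" "card Q = s" "finite Q" using Q by (auto dest: cliques_onD)
        show ?thesis
        proof
          assume "{u, w} \<in> E"
          then have "clique (insert u (insert w Q)) E"
            using ins by (auto simp: cliques_on_def clique_def insert_commute)
          moreover have "u \<notin> insert w Q" "w \<notin> Q" using QN(1) u w False by auto
          ultimately have "insert u (insert w Q) \<in> cliques_on (Suc (Suc s)) U E"
            using QN u w NU(1) by (auto simp: cliques_on_def)
          then show False using Suc.prems(2) by simp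
        qed
      qed
      show ?thesis
        unfolding complete_multipartite_def
      proof (intro conjI ballI)
        fix u assume u: "u \<in> U"
        show "c u < Suc s" using c'(1) by (auto simp: c_def less_Suc_eq)
        fix w assume w: "w \<in> U"
        consider "u \<in> ?N" "w \<in> ?N" | "u \<in> ?N" "w \<in> ?W" | "u \<in> ?W" "w \<in> ?N" | "u \<in> ?W" "w \<in> ?W"
          using u w by blast
        then show "({u, w} \<in> E) = (c u \<noteq> c w)"
        proof cases
          case 1 then show ?thesis using mpN by (simp add: c_def complete_multipartite_def)
        next
          case 2
          then have "c u < s" "c w = s" using c'(1) by (auto simp: c_def)
          then show ?thesis using NW[OF 2(2,1)] by (simp add: insert_commute)
        next
          case 3
          then have "c w < s" "c u = s" using c'(1) by (auto simp: c_def)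
          then show ?thesis using NW[OF 3] by simp
        next
          case 4
          then show ?thesis using WW[OF 4] by (simp add: c_def)
        qed
      qed
    qed
    moreover have "\<forall>u\<in>U. c u < Suc s" using c'(1) by (auto simp: c_def less_Suc_eq)
    ultimately show ?thesis using bound by (intro exI[of _ c] conjI impI)
  qed
qed

section \<open>Products of integers with a given sum\<close>

text \<open>
  The exponential function with the values \<open>a\<close> at \<open>a\<close> and \<open>a + 1\<close> at \<open>a + 1\<close> is convex, so at the other
  integers it lies strictly above the identity.
\<close>

lemma nat_le_exponential:
  fixes a x :: nat
  assumes "0 < a"
  shows "real x \<le> real a * (real (a + 1) / real a) powi (int x - int a)"
    and "x \<noteq> a \<Longrightarrow> x \<noteq> a + 1 \<Longrightarrow> real x < real a * (real (a + 1) / real a) powi (int x - int a)"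
proof -
  have "real x \<le> real a * (real (a + 1) / real a) powi (int x - int a) \<and>
    (x \<noteq> a \<longrightarrow> x \<noteq> a + 1 \<longrightarrow> real x < real a * (real (a + 1) / real a) powi (int x - int a))"
  proof (cases "a \<le> x")
    case True
    then obtain e where e: "x = a + e" using le_Suc_ex by blast
    define \<delta> where "\<delta> = 1 / real a"
    have \<delta>: "\<delta> > 0" using assms by (simp add: \<delta>_def)
    have "1 + real e * \<delta> < (1 + \<delta>) ^ e" if "2 \<le> e"
    proof -
      define d where "d = e - 1"
      have d: "e = Suc d" "1 \<le> d" using that by (auto simp: d_def)
      have "1 + real d * \<delta> \<le> (1 + \<delta>) ^ d" using Bernoulli_inequality[of \<delta> d] \<delta> by simp
      then have "(1 + real d * \<delta>) * (1 + \<delta>) \<le> (1 + \<delta>) ^ e"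
        using \<delta> d(1) by (simp add: mult.commute mult_left_mono)
      moreover have "(1 + real d * \<delta>) * (1 + \<delta>) = 1 + real e * \<delta> + real d * (\<delta> * \<delta>)"
        by (simp add: d(1) algebra_simps)
      moreover have "real d * (\<delta> * \<delta>) > 0" using d(2) \<delta> by simp
      ultimately show ?thesis by linarith
    qed
    moreover have "1 + real e * \<delta> \<le> (1 + \<delta>) ^ e" using Bernoulli_inequality[of \<delta> e] \<delta> by simp
    ultimately have "1 + real e * (1 / a) \<le> (1 + 1 / a) ^ e \<and>
        (2 \<le> e \<longrightarrow> 1 + real e * (1 / a) < (1 + 1 / real a) ^ e)"
      unfolding \<delta>_def by blast
    moreover have "real (a + 1) / real a = 1 + 1 / a" "int x - int a = int e"
      using assms e by (auto simp: field_simps)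
    moreover have "real x = a * (1 + real e * (1 / a))" using assms e by (simp add: field_simps)
    ultimately show ?thesis using assms e by simp
  next
    case False
    define e where "e = a - x"
    define r where "r = real (a + 1) / real a"
    have e: "0 < e" "x = a - e" "e \<le> a" using False by (auto simp: e_def)
    have "1 - real e / (a + 1) \<le> (1 - 1 / real (a + 1)) ^ e"
      using Bernoulli_inequality[of "- (1 / real (a + 1))" e] by (simp add: divide_le_eq_1)
    moreover have "real e / (a + 1) < real e / a" using e assms by (simp add: divide_strict_left_mono)
    ultimately have "1 - real e / a < (1 - 1 / real (a + 1)) ^ e" by simp
    moreover have "1 - 1 / real (a + 1) = inverse r" using assms by (simp add: r_def field_simps)
    ultimately have "real a * (1 - real e / a) < real a * inverse r ^ e" using assms by simp
    moreover have "r powi (int x - int a) = inverse r ^ e"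
      using e by (simp add: power_int_minus power_inverse)
    moreover have "real x = real a * (1 - real e / a)" using assms e by (simp add: of_nat_diff field_simps)
    ultimately have "real x < real a * r powi (int x - int a)" by simp
    then have "real x < real a * (real (a + 1) / real a) powi (int x - int a)" by (simp only: r_def)
    then show ?thesis by simp
  qed
  then show "real x \<le> real a * (real (a + 1) / real a) powi (int x - int a)"
    and "x \<noteq> a \<Longrightarrow> x \<noteq> a + 1 \<Longrightarrow> real x < real a * (real (a + 1) / real a) powi (int x - int a)"
    by auto
qed

text \<open>
  Bounding each factor by \<open>nat_le_exponential\<close> leaves a power whose exponent depends on the sum of
  the factors alone. So the optimum, with its equality case, comes out at once, without moving
  units between unbalanced factors one at a time.
\<close>

lemma
  fixes f :: "nat \<Rightarrow> nat"
  assumes "(\<Sum>i<s. f i) = m" and "0 < m div s"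
  shows prod_le_balanced: "(\<Prod>i<s. f i) \<le> (m div s) ^ (s - m mod s) * (m div s + 1) ^ (m mod s)"
    and prod_eq_balanced:
      "(\<Prod>i<s. f i) = (m div s) ^ (s - m mod s) * (m div s + 1) ^ (m mod s) \<Longrightarrow>
         i < s \<Longrightarrow> f i \<in> {m div s, m div s + 1}"
proof -
  define a b where "a = m div s" and "b = m mod s"
  define g where "g x = real a * (real (a + 1) / real a) powi (int x - int a)" for x :: nat
  have a: "0 < a" using assms by (simp add: a_def)
  have s: "0 < s" using assms(2) by (cases s) auto
  have "b < s" using s by (simp add: b_def)
  have m: "m = s * a + b" by (simp add: a_def b_def)
  have gpos: "g x > 0" for x using a by (simp add: g_def)
  have rpos: "real (a + 1) / real a \<noteq> 0" using a by simp
  have "(\<Prod>i<n. (real (a + 1) / real a) powi (int (f i) - int a))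
        = (real (a + 1) / real a) powi (\<Sum>i<n. int (f i) - int a)" for n
    by (induction n) (use a in \<open>simp_all add: power_int_add\<close>)
  then have "(\<Prod>i<s. g (f i)) = real a ^ s * (real (a + 1) / real a) powi (\<Sum>i<s. int (f i) - int a)"
    unfolding g_def by (simp add: prod.distrib)
  also have "(\<Sum>i<s. int (f i) - int a) = int b"
    using assms(1) m by (simp add: sum_subtractf flip: of_nat_sum)
  also have "real a ^ s * (real (a + 1) / real a) powi int b = real a ^ (s - b) * real (a + 1) ^ b"
    using \<open>b < s\<close> a by (simp add: power_divide power_diff)
  finally have prodg: "(\<Prod>i<s. g (f i)) = real (a ^ (s - b) * (a + 1) ^ b)" by simp
  have "real (\<Prod>i<s. f i) \<le> (\<Prod>i<s. g (f i))"
    unfolding of_nat_prod using nat_le_exponential(1)[OF a] by (intro prod_mono) (auto simp: g_def)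
  then show "(\<Prod>i<s. f i) \<le> (m div s) ^ (s - m mod s) * (m div s + 1) ^ (m mod s)"
    unfolding prodg a_def[symmetric] b_def[symmetric] by (simp only: of_nat_le_iff)
  show "f i \<in> {m div s, m div s + 1}"
    if eq: "(\<Prod>i<s. f i) = (m div s) ^ (s - m mod s) * (m div s + 1) ^ (m mod s)" and "i < s" for i
  proof (rule ccontr)
    assume "f i \<notin> {m div s, m div s + 1}"
    then have lt: "real (f i) < g (f i)"
      using nat_le_exponential(2)[OF a, of "f i"] by (simp add: g_def a_def)
    have eq': "real (\<Prod>i<s. f i) = (\<Prod>i<s. g (f i))"
      unfolding prodg using eq by (simp add: a_def b_def)
    have "real (\<Prod>i<s. f i) > 0" unfolding eq' using gpos by (intro prod_pos) auto
    then have "(\<Prod>i<s. f i) \<noteq> 0" by (simp only: of_nat_0_less_iff)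
    then have fpos: "real (f j) > 0" if "j < s" for j using that by simp
    have "real (\<Prod>i<s. f i) = real (f i) * (\<Prod>j\<in>{..<s}-{i}. real (f j))"
      unfolding of_nat_prod using \<open>i < s\<close> by (intro prod.remove) auto
    also have "\<dots> < g (f i) * (\<Prod>j\<in>{..<s}-{i}. real (f j))"
      using lt fpos by (intro mult_strict_right_mono prod_pos) auto
    also have "\<dots> \<le> g (f i) * (\<Prod>j\<in>{..<s}-{i}. g (f j))"
      using gpos[of "f i"] nat_le_exponential(1)[OF a] by (intro mult_left_mono prod_mono) (auto simp: g_def)
    also have "\<dots> = (\<Prod>i<s. g (f i))"
      using \<open>i < s\<close> by (intro prod.remove[symmetric]) auto
    finally show False using eq' by simp
  qed
qed

section \<open>Families of cliques with small unions\<close>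

text \<open>
  If one of the differences \<open>X - Y\<close> already has \<open>r\<close> vertices, take the first copy inside it.
  Otherwise let the first copy \<open>A\<close> contain all of \<open>X - Y\<close>; then \<open>Y - A\<close> is the rest of \<open>X \<union> Y\<close>.
\<close>

lemma two_disjoint_cliques_contained:
  assumes XY: "X \<in> cliques p G" "Y \<in> cliques p' G" and r: "r \<le> p" "r \<le> p'" "2 * r \<le> card (X \<union> Y)"
  shows "contains_subgraph G (disjoint_union (complete_graph r) (complete_graph r))"
proof -
  have X: "X \<subseteq> verts G" "finite X" "card X = p" "clique X (edges G)"
   and Y: "Y \<subseteq> verts G" "finite Y" "card Y = p'" "clique Y (edges G)"
    using XY unfolding cliques_eq_cliques_on by (auto dest: cliques_onD)
  obtain A where A: "A \<subseteq> X" "card A = r" "r \<le> card (Y - A)"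
  proof (cases "r \<le> card (X - Y)")
    case True
    then obtain A where "A \<subseteq> X - Y" "card A = r" "finite A" by (meson obtain_subset_with_card_n)
    moreover from this have "Y - A = Y" by auto
    ultimately show ?thesis using that[of A] r Y by auto
  next
    case False
    have "card (X - Y) \<le> r" using False by simp
    moreover have "r \<le> card X" using r X by simp
    ultimately obtain A where A: "X - Y \<subseteq> A" "A \<subseteq> X" "card A = r"
      using exists_subset_between[of "X - Y" r X] X by auto
    then have "Y - A = (X \<union> Y) - A" by auto
    then have "card (Y - A) = card (X \<union> Y) - r"
      using A X by (simp add: card_Diff_subset finite_subset le_supI1)
    then show ?thesis using that[of A] A r(3) by simp
  qed
  obtain B where B: "B \<subseteq> Y - A" "card B = r" "finite B"
    using A(3) by (meson obtain_subset_with_card_n)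
  have "finite A" using A(1) X(2) by (rule finite_subset)
  obtain f where f: "bij_betw f {..<r} A"
    using A(2) \<open>finite A\<close> ex_bij_betw_nat_finite[of A] by (auto simp: atLeast0LessThan)
  obtain g where g: "bij_betw g {..<r} B"
    using B ex_bij_betw_nat_finite[of B] by (auto simp: atLeast0LessThan)
  have clA: "clique A (edges G)" and clB: "clique B (edges G)"
    using A B X Y by (auto intro: clique_subset)
  have edge: "f ` e \<in> E" if f: "bij_betw f {..<r} A" and A: "clique A E" and e: "e \<in> [{..<r}]\<^bsup>2\<^esup>"
    for f :: "nat \<Rightarrow> 'a" and A E e
  proof -
    obtain i j where e: "e = {i, j}" "i \<noteq> j" "i < r" "j < r"
      using e by (auto simp: nsets_def card_2_iff)
    then have "f i \<noteq> f j" "f i \<in> A" "f j \<in> A"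
      using f by (auto simp: bij_betw_def inj_on_def)
    then show ?thesis using A e by (simp add: clique_def)
  qed
  let ?F = "disjoint_union (complete_graph r) (complete_graph r)"
  let ?h = "case_sum f g"
  have "f i \<noteq> g j \<and> g j \<noteq> f i" if "i < r" "j < r" for i j
  proof -
    have "f i \<in> A" "g j \<in> B" using bij_betwE[OF f] bij_betwE[OF g] that by auto
    then show ?thesis using B(1) by auto
  qed
  then have "inj_on ?h (verts ?F)"
    using f g
    by (auto simp: disjoint_union_def complete_graph_def inj_on_def bij_betw_def)
  moreover have "?h ` verts ?F \<subseteq> verts G"
  proof -
    have "f ` {..<r} \<subseteq> verts G" "g ` {..<r} \<subseteq> verts G"
      using bij_betw_imp_surj_on[OF f] bij_betw_imp_surj_on[OF g] A(1) B(1) X(1) Y(1) by auto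
    then show ?thesis by (auto simp: disjoint_union_def complete_graph_def)
  qed
  moreover have "\<forall>e\<in>edges ?F. ?h ` e \<in> edges G"
    using edge[OF f clA] edge[OF g clB]
    by (auto simp: disjoint_union_def complete_graph_def image_image)
  ultimately show ?thesis unfolding contains_subgraph_def by blast
qed

lemma card_subsets_up_to:
  assumes "finite W"
  shows "card {Y. Y \<subseteq> W \<and> card Y < j} = (\<Sum>i<j. card W choose i)"
proof -
  have "{Y. Y \<subseteq> W \<and> card Y < j} = (\<Union>i<j. {Y. Y \<subseteq> W \<and> card Y = i})" by auto
  also have "card \<dots> = (\<Sum>i<j. card {Y. Y \<subseteq> W \<and> card Y = i})"
    using assms by (intro card_UN_disjoint) auto
  finally show ?thesis using assms by (simp add: n_subsets)
qed

text \<open>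
  A counting scheme: a member \<open>X\<close> of the family is determined by its trace \<open>X \<inter> A\<close>, a seed chosen
  from a short list that depends on the trace only, and fewer than \<open>j\<close> further vertices.
\<close>

lemma card_family_via_trace:
  assumes "finite V" and "A \<subseteq> V" and "\<And>X. X \<in> F \<Longrightarrow> X \<subseteq> V"
    and seeds: "\<And>T. T \<subseteq> A \<Longrightarrow> finite (Z T) \<and> card (Z T) \<le> z"
    and cover: "\<And>X. X \<in> F \<Longrightarrow> \<exists>S\<in>Z (X \<inter> A). \<exists>Y. Y \<subseteq> V - A \<and> card Y < j \<and> X = (X \<inter> A) \<union> S \<union> Y"
  shows "card F \<le> 2 ^ card A * (z * (\<Sum>i<j. (card V - card A) choose i))"
proof -
  let ?Y = "{Y. Y \<subseteq> V - A \<and> card Y < j}"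
  have finA: "finite A" using assms(1,2) by (rule finite_subset[rotated])
  have finY: "finite ?Y" using assms(1) by simp
  have cY: "card ?Y = (\<Sum>i<j. (card V - card A) choose i)"
    using assms(1,2) finA by (subst card_subsets_up_to) (simp_all add: card_Diff_subset)
  let ?D = "\<lambda>T. \<Union>S\<in>Z T. (\<lambda>Y. T \<union> S \<union> Y) ` ?Y"
  have "F \<subseteq> (\<Union>T\<in>Pow A. ?D T)"
  proof
    fix X assume "X \<in> F"
    from cover[OF this] obtain S Y where SY: "S \<in> Z (X \<inter> A)" "Y \<in> ?Y" "X = (X \<inter> A) \<union> S \<union> Y" by blast
    have "X \<in> (\<lambda>Y. (X \<inter> A) \<union> S \<union> Y) ` ?Y" by (rule image_eqI[where x = Y]) (rule SY)+
    then have "X \<in> ?D (X \<inter> A)" by (rule UN_I[OF SY(1)])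
    moreover have "X \<inter> A \<in> Pow A" by simp
    ultimately show "X \<in> (\<Union>T\<in>Pow A. ?D T)" by (rule UN_I[rotated])
  qed
  then have "card F \<le> card (\<Union>T\<in>Pow A. ?D T)"
    using finA seeds finY by (intro card_mono finite_UN_I) auto
  also have "\<dots> \<le> (\<Sum>T\<in>Pow A. card (?D T))" using finA by (intro card_UN_le) auto
  also have "\<dots> \<le> (\<Sum>T\<in>Pow A. z * card ?Y)"
  proof (rule sum_mono)
    fix T assume "T \<in> Pow A"
    then have fc: "finite (Z T)" "card (Z T) \<le> z" using seeds by auto
    have "card (?D T) \<le> (\<Sum>S\<in>Z T. card ((\<lambda>Y. T \<union> S \<union> Y) ` ?Y))" by (rule card_UN_le[OF fc(1)])
    also have "\<dots> \<le> (\<Sum>S\<in>Z T. card ?Y)" by (intro sum_mono card_image_le finY)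
    also have "\<dots> \<le> z * card ?Y" using fc(2) by simp
    finally show "card (?D T) \<le> z * card ?Y" .
  qed
  also have "\<dots> = 2 ^ card A * (z * card ?Y)" using finA by (simp add: card_Pow)
  finally show ?thesis unfolding cY .
qed

text \<open>
  The point is that only \<open>s - 1\<close> vertices of a member are chosen freely, although a member may have \<open>s\<close>
  vertices outside \<open>A\<close>. If the family has a member \<open>B = insert b A\<close> then all but \<open>s - 1\<close> vertices of
  any member lie in \<open>B\<close>, and the seed records whether \<open>b\<close> is used. Otherwise a member with \<open>s\<close>
  vertices outside \<open>A\<close> has a trace \<open>T\<close> of size \<open>k - s\<close>. Some member \<open>C\<close> does not contain \<open>T\<close>, but
  two members share at least \<open>k - s\<close> vertices; so outside \<open>A\<close> the member meets \<open>C\<close>, in one of at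
  most \<open>s\<close> vertices, and such a vertex is the seed.
\<close>

lemma card_nonstar_family:
  assumes "finite V" and FV: "\<And>X. X \<in> F \<Longrightarrow> X \<subseteq> V" and A: "A \<subseteq> V" "card A = k"
    and s: "0 < s" "s \<le> k" and "A \<in> F"
    and union: "\<And>X Y. X \<in> F \<Longrightarrow> Y \<in> F \<Longrightarrow> card (X \<union> Y) \<le> k + s"
    and alt: "(\<exists>B\<in>F. A \<subseteq> B \<and> card B = Suc k) \<or>
      (\<forall>X\<in>F. card X = k) \<and> (\<forall>T. T \<subseteq> A \<longrightarrow> card T = k - s \<longrightarrow> (\<exists>C\<in>F. \<not> T \<subseteq> C))"
  shows "card F \<le> 2 ^ k * (Suc s * (\<Sum>i<s. (card V - k) choose i))"
proof -
  have finA: "finite A" using assms(1) A(1) by (rule finite_subset[rotated])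
  have finX: "finite X" if "X \<in> F" for X using FV[OF that] assms(1) by (rule finite_subset)
  have diff: "card (X - B) + card B \<le> k + s" if "X \<in> F" "B \<in> F" for X B
  proof -
    have "card (X \<union> B) = card (X - B) + card B"
      using finX that by (metis Un_Diff_cancel2 card_Un_disjoint Diff_disjoint finite_Diff inf_commute)
    then show ?thesis using union[OF that] by simp
  qed
  consider B where "B \<in> F" "A \<subseteq> B" "card B = Suc k"
    | "\<forall>X\<in>F. card X = k" "\<forall>T. T \<subseteq> A \<longrightarrow> card T = k - s \<longrightarrow> (\<exists>C\<in>F. \<not> T \<subseteq> C)"
    using alt by blast
  then show ?thesis
  proof cases
    case 1
    have "card (B - A) = 1" using 1 A finA by (simp add: card_Diff_subset)
    then obtain b where b: "B - A = {b}" by (auto simp: card_1_singleton_iff)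
    have cover: "\<exists>S\<in>{{}, {b}}. \<exists>Y. Y \<subseteq> V - A \<and> card Y < s \<and> X = (X \<inter> A) \<union> S \<union> Y" if "X \<in> F" for X
    proof (intro bexI exI conjI)
      show "X - B \<subseteq> V - A" using FV[OF that] 1(2) by auto
      show "card (X - B) < s" using diff[OF that 1(1)] 1(3) by simp
      have "B = insert b A" using b 1(2) by auto
      then show "X = (X \<inter> A) \<union> (X \<inter> {b}) \<union> (X - B)" by auto
      show "X \<inter> {b} \<in> {{}, {b}}" by auto
    qed
    have "card {{}, {b}} \<le> Suc s" using s by simp
    then show ?thesis
      using card_family_via_trace[OF assms(1) A(1) FV _ cover, where z = "Suc s"] A(2) by simp
  next
    case 2
    have "\<forall>T\<in>Pow A. \<exists>C. C \<in> F \<and> (card T = k - s \<longrightarrow> \<not> T \<subseteq> C)"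
    proof
      fix T assume "T \<in> Pow A"
      then show "\<exists>C. C \<in> F \<and> (card T = k - s \<longrightarrow> \<not> T \<subseteq> C)"
        using 2(2) assms(7) by (cases "card T = k - s") (blast, auto)
    qed
    from bchoice[OF this] obtain C where
      C: "\<And>T. T \<subseteq> A \<Longrightarrow> C T \<in> F" "\<And>T. T \<subseteq> A \<Longrightarrow> card T = k - s \<Longrightarrow> \<not> T \<subseteq> C T" by auto
    define Z where "Z T = insert {} ((\<lambda>y. {y}) ` (C T - A))" for T
    have cZ: "finite (Z T) \<and> card (Z T) \<le> Suc s" if "T \<subseteq> A" for T
    proof -
      have fin: "finite (C T - A)" using finX C(1)[OF that] by auto
      have "card ((\<lambda>y. {y}) ` (C T - A)) \<le> card (C T - A)" using fin by (rule card_image_le)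
      also have "\<dots> \<le> s" using diff[OF C(1)[OF that] assms(7)] A(2) by simp
      finally show ?thesis using fin by (auto simp: Z_def card_insert_if)
    qed
    have cover: "\<exists>S\<in>Z (X \<inter> A). \<exists>Y. Y \<subseteq> V - A \<and> card Y < s \<and> X = (X \<inter> A) \<union> S \<union> Y" if X: "X \<in> F" for X
    proof (cases "card (X - A) < s")
      case True
      then show ?thesis using FV[OF X] by (intro bexI[of _ "{}"] exI[of _ "X - A"]) (auto simp: Z_def)
    next
      case False
      then have cXA: "card (X - A) = s" using diff[OF X assms(7)] A(2) by simp
      let ?T = "X \<inter> A"
      have "card X = card ?T + card (X - A)"
        using finX[OF X] by (metis card_Int_Diff)
      then have cT: "card ?T = k - s" using 2(1) X cXA by simp
      have CT: "C ?T \<in> F" "\<not> ?T \<subseteq> C ?T" using C(1)[of ?T] C(2)[OF _ cT] by auto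
      have "(X - A) \<inter> C ?T \<noteq> {}"
      proof
        assume "(X - A) \<inter> C ?T = {}"
        then have sub: "X \<inter> C ?T \<subseteq> ?T" by auto
        have "card (X \<union> C ?T) + card (X \<inter> C ?T) = k + k"
          using card_Un_Int[OF finX[OF X] finX[OF CT(1)]] 2(1) X CT(1) by simp
        then have "k - s \<le> card (X \<inter> C ?T)" using union[OF X CT(1)] by simp
        then have "X \<inter> C ?T = ?T" using sub cT finA by (intro card_seteq) auto
        then show False using CT(2) by auto
      qed
      then obtain y where y: "y \<in> X - A" "y \<in> C ?T" by auto
      show ?thesis
      proof (intro bexI exI conjI)
        show "X - A - {y} \<subseteq> V - A" using FV[OF X] by auto
        show "card (X - A - {y}) < s" using y cXA s finX[OF X] by simp
        show "X = ?T \<union> {y} \<union> (X - A - {y})" using y by auto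
        show "{y} \<in> Z ?T" using y by (auto simp: Z_def)
      qed
    qed
    show ?thesis using card_family_via_trace[OF assms(1) A(1) FV cZ cover] A(2) by simp
  qed
qed

section \<open>Isomorphisms of complete multipartite graphs\<close>

text \<open>
  The isomorphism is glued from bijections between the classes. The permutation \<open>\<sigma>\<close> is explicit
  because a colouring comes without any order of its classes.
\<close>

lemma graph_iso_multipartite:
  assumes "finite (verts G)" "finite (verts H)"
    and G: "complete_multipartite (verts G) (edges G) k c"
    and H: "complete_multipartite (verts H) (edges H) k c'"
    and \<sigma>: "bij_betw \<sigma> {..<k} {..<k}"
    and sizes: "\<And>i. i < k \<Longrightarrow> card (colour_class (verts G) c i) = card (colour_class (verts H) c' (\<sigma> i))"
  shows "graph_iso G H"
proof -
  have "\<forall>i\<in>{..<k}. \<exists>f. bij_betw f (colour_class (verts G) c i) (colour_class (verts H) c' (\<sigma> i))"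
    using sizes assms(1,2) by (auto intro!: finite_same_card_bij)
  from bchoice[OF this] obtain f where
    f: "\<And>i. i < k \<Longrightarrow> bij_betw (f i) (colour_class (verts G) c i) (colour_class (verts H) c' (\<sigma> i))" by auto
  define h where "h v = f (c v) v" for v
  have ck: "c v < k" if "v \<in> verts G" for v using G that by (simp add: complete_multipartite_def)
  have h: "h v \<in> verts H" "c' (h v) = \<sigma> (c v)" if "v \<in> verts G" for v
    using bij_betwE[OF f[OF ck[OF that]]] that by (auto simp: h_def)
  have \<sigma>inj: "\<sigma> i = \<sigma> j \<longleftrightarrow> i = j" if "i < k" "j < k" for i j
    using \<sigma> that by (auto simp: bij_betw_def inj_on_def)
  have "inj_on h (verts G)"
  proof (rule inj_onI)
    fix u v assume uv: "u \<in> verts G" "v \<in> verts G" "h u = h v"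
    then have "c u = c v" using h(2)[OF uv(1)] h(2)[OF uv(2)] \<sigma>inj[OF ck[OF uv(1)] ck[OF uv(2)]] by simp
    then have "f (c u) u = f (c u) v" using uv(3) by (simp add: h_def)
    then show "u = v"
      using f[OF ck[OF uv(1)]] uv \<open>c u = c v\<close> by (auto simp: bij_betw_def inj_on_def)
  qed
  moreover have "h ` verts G = verts H"
  proof (intro equalityI subsetI)
    fix w assume w: "w \<in> verts H"
    then have "c' w \<in> \<sigma> ` {..<k}" using H \<sigma> by (simp add: complete_multipartite_def bij_betw_def)
    then obtain i where i: "i < k" "c' w = \<sigma> i" by auto
    then have "w \<in> f i ` colour_class (verts G) c i" using f[OF i(1)] w by (auto simp: bij_betw_def)
    then show "w \<in> h ` verts G" by (auto simp: h_def)
  qed (use h in auto)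
  moreover have "{u, v} \<in> edges G \<longleftrightarrow> {h u, h v} \<in> edges H" if "u \<in> verts G" "v \<in> verts G" for u v
    using G H h[OF that(1)] h[OF that(2)] \<sigma>inj[OF ck[OF that(1)] ck[OF that(2)]] that
    by (simp add: complete_multipartite_def)
  ultimately show ?thesis unfolding graph_iso_def bij_betw_def by blast
qed

lemma multipartite_of_graph_iso:
  assumes "graph_iso G H" and H: "complete_multipartite (verts H) (edges H) k c"
  shows "\<exists>f. complete_multipartite (verts G) (edges G) k (c \<circ> f) \<and>
    (\<forall>i. card (colour_class (verts G) (c \<circ> f) i) = card (colour_class (verts H) c i))"
proof -
  obtain f where f: "bij_betw f (verts G) (verts H)"
    "\<And>u v. u \<in> verts G \<Longrightarrow> v \<in> verts G \<Longrightarrow> {u, v} \<in> edges G \<longleftrightarrow> {f u, f v} \<in> edges H"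
    using assms(1) unfolding graph_iso_def by blast
  have fV: "f v \<in> verts H" if "v \<in> verts G" for v using f(1) that by (auto simp: bij_betw_def)
  have "complete_multipartite (verts G) (edges G) k (c \<circ> f)"
    using H fV f(2) by (simp add: complete_multipartite_def)
  moreover have "card (colour_class (verts G) (c \<circ> f) i) = card (colour_class (verts H) c i)" for i
  proof (rule bij_betw_same_card)
    show "bij_betw f (colour_class (verts G) (c \<circ> f) i) (colour_class (verts H) c i)"
      using f(1) by (auto simp: bij_betw_def inj_on_def)
  qed
  ultimately show ?thesis by blast
qed

section \<open>Cliques through a common kernel\<close>

text \<open>
  The product of the part sizes of the Turan graph with \<open>s\<close> parts on \<open>m\<close> vertices: \<open>m mod s\<close> parts
  have \<open>m div s + 1\<close> vertices and the others have \<open>m div s\<close>. For \<open>s = 0\<close> it is the empty product \<open>1\<close>.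
\<close>

definition balanced_product :: "nat \<Rightarrow> nat \<Rightarrow> nat" where
  "balanced_product s m = (m div s) ^ (s - m mod s) * (m div s + 1) ^ (m mod s)"

text \<open>
  A larger clique contains a \<open>k\<close>-clique that avoids a given vertex of \<open>T\<close>.
\<close>

lemma star_no_larger_cliques:
  assumes "finite V" and "T \<noteq> {}" and star: "\<And>K. K \<in> cliques_on k V E \<Longrightarrow> T \<subseteq> K" and "k < p"
  shows "cliques_on p V E = {}"
proof (rule ccontr)
  assume "cliques_on p V E \<noteq> {}"
  then obtain B where "B \<in> cliques_on p V E" by auto
  then have B: "B \<subseteq> V" "finite B" "card B = p" "clique B E" by (rule cliques_onD)+
  obtain u where u: "u \<in> T" using assms(2) by auto
  have "k \<le> card (B - {u})" using B(2,3) assms(4) by (auto simp: card_Diff_singleton_if)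
  then obtain K where K: "K \<subseteq> B - {u}" "card K = k" "finite K" by (meson obtain_subset_with_card_n)
  then have "K \<in> cliques_on k V E" using B by (auto simp: cliques_on_def intro: clique_subset)
  then have "u \<in> K" using star u by auto
  then show False using K(1) by auto
qed

lemma sum_colour_classes:
  assumes "finite W" and "\<And>u. u \<in> W \<Longrightarrow> c u < s"
  shows "(\<Sum>i<s. card (colour_class W c i)) = card W"
proof -
  have "W = (\<Union>i<s. colour_class W c i)" using assms(2) by auto
  also have "card \<dots> = (\<Sum>i<s. card (colour_class W c i))"
    using assms(1) by (intro card_UN_disjoint) auto
  finally show ?thesis by simp
qed

text \<open>
  Deleting the kernel \<open>T\<close> turns the cliques into \<open>s\<close>-cliques of the common neighbourhood of \<open>T\<close>. An
  \<open>(s + 1)\<close>-clique there would give, with \<open>T\<close>, a larger clique of the graph, so Zykov's bound applies.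
  Under equality the common neighbourhood has to be the whole complement of \<open>T\<close>.
\<close>

lemma
  fixes E :: "'a set set"
  assumes "finite V" and loopless: "\<And>u. {u} \<notin> E" and T: "T \<subseteq> V" "T \<noteq> {}" and "0 < s"
    and star: "\<And>K. K \<in> cliques_on (card T + s) V E \<Longrightarrow> T \<subseteq> K"
    and pos: "0 < card (V - T) div s"
  shows card_star_cliques_le:
      "card (cliques_on (card T + s) V E) \<le> balanced_product s (card (V - T))"
    and star_cliques_extremal:
      "card (cliques_on (card T + s) V E) = balanced_product s (card (V - T)) \<Longrightarrow>
         \<exists>c. complete_multipartite (V - T) E s c \<and>
             (\<forall>i<s. card (colour_class (V - T) c i) \<in> {card (V - T) div s, card (V - T) div s + 1}) \<and>
             clique T E \<and> (\<forall>u\<in>T. \<forall>w\<in>V - T. {u, w} \<in> E)"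
proof -
  let ?t = "card T" let ?W = "V - T" let ?C = "cliques_on (card T + s) V E"
  let ?m = "card ?W"
  have finT: "finite T" using T assms(1) by (metis finite_subset)
  define W0 where "W0 = {w\<in>?W. \<forall>u\<in>T. {u, w} \<in> E}"
  have finW: "finite ?W" "finite W0" using assms(1) by (auto simp: W0_def)
  have bal_pos: "0 < balanced_product s ?m" using pos by (simp add: balanced_product_def)
  have "card ?C \<le> balanced_product s ?m \<and> (card ?C = balanced_product s ?m \<longrightarrow>
         (\<exists>c. complete_multipartite ?W E s c \<and>
             (\<forall>i<s. card (colour_class ?W c i) \<in> {?m div s, ?m div s + 1}) \<and>
             clique T E \<and> (\<forall>u\<in>T. \<forall>w\<in>?W. {u, w} \<in> E)))"
  proof (cases "?C = {}")
    case True
    then show ?thesis using bal_pos by auto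
  next
    case False
    then obtain K0 where K0: "K0 \<in> ?C" by auto
    then have clT: "clique T E" using star[OF K0] by (auto dest: cliques_onD intro: clique_subset)
    have free: "cliques_on (Suc s) W0 E = {}"
    proof (rule ccontr)
      assume "cliques_on (Suc s) W0 E \<noteq> {}"
      then obtain S where "S \<in> cliques_on (Suc s) W0 E" by auto
      then have S: "S \<subseteq> W0" "finite S" "card S = Suc s" "clique S E" by (rule cliques_onD)+
      have disj: "T \<inter> S = {}" using S(1) by (auto simp: W0_def)
      have "clique (T \<union> S) E"
        unfolding clique_def
      proof (intro ballI impI)
        fix u w assume uw: "u \<in> T \<union> S" "w \<in> T \<union> S" "u \<noteq> w"
        have cross: "{a, b} \<in> E" if "a \<in> T" "b \<in> S" for a b
          using that S(1) by (auto simp: W0_def)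
        show "{u, w} \<in> E"
          using uw clT S(4) cross[of u w] cross[of w u] by (auto simp: clique_def insert_commute)
      qed
      moreover have "card (T \<union> S) = ?t + s + 1"
        using disj S finT by (simp add: card_Un_disjoint)
      moreover have "T \<union> S \<subseteq> V" using T S(1) by (auto simp: W0_def)
      ultimately have "T \<union> S \<in> cliques_on (?t + s + 1) V E"
        using finT S(2) by (simp add: cliques_on_def)
      moreover have "cliques_on (?t + s + 1) V E = {}"
        by (rule star_no_larger_cliques[where k = "?t + s", OF assms(1) T(2) star]) auto
      ultimately show False by simp
    qed
    have "(\<lambda>K. K - T) ` ?C \<subseteq> cliques_on s W0 E"
    proof (rule image_subsetI)
      fix K assume K: "K \<in> ?C"
      note Kd = cliques_onD[OF K] star[OF K]
      have "K - T \<subseteq> W0"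
      proof
        fix w assume w: "w \<in> K - T"
        then have "{u, w} \<in> E" if "u \<in> T" for u
          using Kd(4,5) that by (auto simp: clique_def)
        then show "w \<in> W0" using w Kd(1) by (auto simp: W0_def)
      qed
      moreover have "card (K - T) = s" using Kd finT by (simp add: card_Diff_subset)
      moreover have "clique (K - T) E" using Kd(4) by (rule clique_subset) auto
      ultimately show "K - T \<in> cliques_on s W0 E" using Kd(2) by (simp add: cliques_on_def)
    qed
    moreover have "inj_on (\<lambda>K. K - T) ?C"
    proof (rule inj_onI)
      fix K L assume "K \<in> ?C" "L \<in> ?C" and eq: "K - T = L - T"
      then have "T \<subseteq> K" "T \<subseteq> L" using star by auto
      then have "K = (K - T) \<union> T" "L = (L - T) \<union> T" by auto
      then show "K = L" using eq by simp
    qed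
    ultimately have le1: "card ?C \<le> card (cliques_on s W0 E)"
      using finW(2) by (intro card_inj_on_le[of "\<lambda>K. K - T"]) auto
    obtain c where c: "(\<forall>u\<in>W0. c u < s) \<and>
        card (cliques_on s W0 E) \<le> (\<Prod>i<s. card (colour_class W0 c i)) \<and>
        (card (cliques_on s W0 E) = (\<Prod>i<s. card (colour_class W0 c i)) \<longrightarrow>
            0 < card (cliques_on s W0 E) \<longrightarrow> complete_multipartite W0 E s c)"
      using zykov_clique_bound[OF finW(2) loopless assms(5) free] by (elim exE)
    (* The vertices outside the common neighbourhood join class 0. This does not decrease the
       product, and increases it strictly if there are any such vertices. *)
    define c1 where "c1 u = (if u \<in> W0 then c u else 0)" for u
    have W0W: "W0 \<subseteq> ?W" by (auto simp: W0_def)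
    have c1: "c1 u < s" for u using c assms(5) by (simp add: c1_def)
    have sub: "colour_class W0 c i \<subseteq> colour_class ?W c1 i" for i
      using W0W by (auto simp: c1_def)
    have cle: "card (colour_class W0 c i) \<le> card (colour_class ?W c1 i)" for i
      by (rule card_mono[OF finite_subset[OF _ finW(1)] sub]) auto
    have le2: "(\<Prod>i<s. card (colour_class W0 c i)) \<le> (\<Prod>i<s. card (colour_class ?W c1 i))"
      by (intro prod_mono conjI cle) simp
    have total: "(\<Sum>i<s. card (colour_class ?W c1 i)) = ?m"
      by (rule sum_colour_classes[OF finW(1)]) (rule c1)
    have le3: "(\<Prod>i<s. card (colour_class ?W c1 i)) \<le> balanced_product s ?m"
      using prod_le_balanced[OF total pos] by (simp add: balanced_product_def)
    have "\<exists>c. complete_multipartite ?W E s c \<and>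
             (\<forall>i<s. card (colour_class ?W c i) \<in> {?m div s, ?m div s + 1}) \<and>
             clique T E \<and> (\<forall>u\<in>T. \<forall>w\<in>?W. {u, w} \<in> E)"
      if eq: "card ?C = balanced_product s ?m"
    proof -
      have eqs: "card (cliques_on s W0 E) = balanced_product s ?m"
        "(\<Prod>i<s. card (colour_class W0 c i)) = balanced_product s ?m"
        "(\<Prod>i<s. card (colour_class ?W c1 i)) = balanced_product s ?m"
        using eq le1 le2 le3 c by auto
      have mp: "complete_multipartite W0 E s c" using c eqs bal_pos by simp
      have sizes: "card (colour_class ?W c1 i) \<in> {?m div s, ?m div s + 1}" if "i < s" for i
        using prod_eq_balanced[OF total pos _ that] eqs(3) by (simp add: balanced_product_def)
      have "W0 = ?W"
      proof (rule ccontr)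
        assume "W0 \<noteq> ?W"
        then obtain w where w: "w \<in> ?W" "w \<notin> W0" using W0W by auto
        then have "colour_class W0 c 0 \<subset> colour_class ?W c1 0" using sub[of 0] by (auto simp: c1_def)
        then have lt: "card (colour_class W0 c 0) < card (colour_class ?W c1 0)"
          by (rule psubset_card_mono[OF finite_subset[OF _ finW(1)], rotated]) auto
        have prod_split: "(\<Prod>i<s. f i) = f 0 * (\<Prod>i\<in>{..<s}-{0}. f i)" for f :: "nat \<Rightarrow> nat"
          using assms(5) by (intro prod.remove) auto
        have "(\<Prod>i<s. card (colour_class ?W c1 i)) > 0" using eqs bal_pos by simp
        then have "(\<Prod>i\<in>{..<s}-{0}. card (colour_class ?W c1 i)) > 0"
          by (subst (asm) prod_split) simp
        moreover have "(\<Prod>i\<in>{..<s}-{0}. card (colour_class W0 c i)) \<le> (\<Prod>i\<in>{..<s}-{0}. card (colour_class ?W c1 i))"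
          by (intro prod_mono conjI cle) simp
        ultimately have "card (colour_class W0 c 0) * (\<Prod>i\<in>{..<s}-{0}. card (colour_class W0 c i))
            < card (colour_class ?W c1 0) * (\<Prod>i\<in>{..<s}-{0}. card (colour_class ?W c1 i))"
          using lt by (meson le_less_trans mult_le_mono2 mult_less_mono1)
        then show False
          using eqs(2,3) prod_split[of "\<lambda>i. card (colour_class W0 c i)"]
            prod_split[of "\<lambda>i. card (colour_class ?W c1 i)"] by linarith
      qed
      then have "colour_class ?W c1 i = colour_class ?W c i" for i by (auto simp: c1_def)
      then show ?thesis using mp sizes \<open>W0 = ?W\<close> clT by (intro exI[of _ c]) (auto simp: W0_def)
    qed
    then show ?thesis using le1 le2 le3 c by auto
  qed
  then show "card ?C \<le> balanced_product s ?m"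
    and "card ?C = balanced_product s ?m \<Longrightarrow>
         \<exists>c. complete_multipartite ?W E s c \<and>
             (\<forall>i<s. card (colour_class ?W c i) \<in> {?m div s, ?m div s + 1}) \<and>
             clique T E \<and> (\<forall>u\<in>T. \<forall>w\<in>?W. {u, w} \<in> E)"
    by blast+
qed

section \<open>The numerical threshold\<close>

lemma exp_two_less_8: "exp (2::real) < 8"
proof -
  have "exp (2::real) = exp 1 * exp 1" by (simp flip: exp_add)
  also have "\<dots> < (272/100) * (272/100)" using e_less_272 by (intro mult_strict_mono) auto
  also have "\<dots> < 8" by simp
  finally show ?thesis .
qed

text \<open>
  The function \<open>x \<mapsto> x powr (x / 2) / (2 * exp 1) powr x\<close> has its minimum at \<open>x = 4 * exp 1\<close>. The proof uses
  \<open>exp 1 * y \<le> exp y\<close> at \<open>y = 4 * exp 1 / k\<close>, which is sharp at that minimum.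
\<close>

lemma two_power_exp_le:
  assumes "4 \<le> k"
  shows "2 ^ k * exp (real k - 2) \<le> 64 * sqrt (real k) ^ k"
proof (rule power2_le_imp_le)
  have k: "real k > 0" using assms by simp
  have "exp 1 * (4 * exp 1 / real k) \<le> exp (4 * exp 1 / real k)"
    using exp_ge_add_one_self[of "4 * exp 1 / real k - 1"] by (simp add: exp_diff field_simps)
  then have "(exp 1 * (4 * exp 1 / real k)) ^ k \<le> exp (4 * exp 1 / real k) ^ k"
    using k by (intro power_mono) auto
  also have "\<dots> = exp (4 * exp 1)" using k by (simp flip: exp_of_nat_mult)
  also have "(exp 1 * (4 * exp 1 / real k)) ^ k = 4 ^ k * exp (2 * real k) / real k ^ k"
  proof -
    have "exp 1 * (4 * exp 1 / real k) = 4 * exp 2 / real k" by (simp flip: exp_add)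
    moreover have "exp (2 * real k) = exp 2 ^ k" by (rule exp_of_nat2_mult)
    ultimately show ?thesis by (simp only: power_divide power_mult_distrib)
  qed
  finally have "4 ^ k * exp (2 * real k) \<le> exp (4 * exp 1) * real k ^ k"
    using k by (simp add: field_simps)
  then have "4 ^ k * exp (2 * real k) * exp (-4) \<le> exp (4 * exp 1) * real k ^ k * exp (-4)"
    by (rule mult_right_mono) simp
  also have "\<dots> = exp (exp 1 - 1) ^ 4 * real k ^ k"
    by (simp flip: exp_of_nat_mult exp_add add: algebra_simps)
  also have "\<dots> \<le> 8 ^ 4 * real k ^ k"
  proof (intro mult_right_mono power_mono)
    have "exp (exp 1 - 1) \<le> exp (2::real)" using e_less_272 by (simp add: less_imp_le)
    then show "exp (exp 1 - 1) \<le> (8::real)" using exp_two_less_8 by linarith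
  qed auto
  finally have main: "4 ^ k * exp (2 * real k) * exp (-4) \<le> 4096 * real k ^ k" by simp
  have "(2 ^ k * exp (real k - 2))\<^sup>2 = 4 ^ k * exp (2 * real k) * exp (-4)"
  proof -
    have "(2 ^ k)\<^sup>2 = (4 :: real) ^ k" by (simp add: power2_eq_square flip: power_mult_distrib)
    moreover have "(exp (real k - 2))\<^sup>2 = exp (2 * real k) * exp (-4)"
      by (simp add: power2_eq_square flip: exp_add)
    ultimately show ?thesis by (simp add: power_mult_distrib)
  qed
  moreover have "(64 * sqrt (real k) ^ k)\<^sup>2 = 4096 * real k ^ k"
  proof -
    have "(sqrt (real k) ^ k)\<^sup>2 = ((sqrt (real k))\<^sup>2) ^ k" by (simp only: power_commutes flip: power_mult) (simp add: mult.commute)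
    then show ?thesis by (simp add: power_mult_distrib)
  qed
  ultimately show "(2 ^ k * exp (real k - 2))\<^sup>2 \<le> (64 * sqrt (real k) ^ k)\<^sup>2" using main by simp
qed simp

text \<open>
  For \<open>r = 3\<close> the bound of \<open>two_power_exp_le\<close> is too weak, because \<open>3 ^ 3 < 64\<close>; the two possible
  values of \<open>k\<close> are then checked directly.
\<close>

lemma clique_count_constant_le:
  assumes "3 \<le> r" and "r \<le> k" and "k \<le> 2 * r - 2"
  shows "2 ^ k * exp (real r - 2) \<le> real r ^ 3 * sqrt (real k) ^ k"
proof (cases "r = 3")
  case True
  then consider "k = 3" | "k = 4" using assms by linarith
  then show ?thesis
  proof cases
    case 1
    have "sqrt 3 ^ 3 \<ge> (1::real)" by (rule one_le_power) simp
    moreover have "exp (1::real) \<le> 3" by (rule exp_le)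
    ultimately have "8 * exp 1 \<le> 27 * sqrt 3 ^ 3" by linarith
    then show ?thesis using True 1 by simp
  next
    case 2
    then show ?thesis using exp_le True by simp
  qed
next
  case False
  then have r: "4 \<le> r" using assms(1) by simp
  have "2 ^ k * exp (real r - 2) \<le> 2 ^ k * exp (real k - 2)" using assms(2) by simp
  also have "\<dots> \<le> 64 * sqrt (real k) ^ k" using r assms(2) by (intro two_power_exp_le) simp
  also have "\<dots> \<le> real r ^ 3 * sqrt (real k) ^ k"
  proof (rule mult_right_mono)
    have "(4::real) ^ 3 \<le> real r ^ 3" using r by (intro power_mono) auto
    then show "64 \<le> real r ^ 3" by simp
  qed simp
  finally show ?thesis .
qed

text \<open>
  Writing \<open>M = s * q\<close>, the estimate \<open>M choose i \<le> M ^ i / i!\<close> produces the partial sums of the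
  exponential series at \<open>s\<close>.
\<close>

lemma sum_binomial_le:
  assumes "0 < s" and "real M = real s * q" and "1 \<le> q"
  shows "real (\<Sum>i<s. M choose i) \<le> exp (real s) * q ^ (s - 1)"
proof -
  have "real (M choose i) \<le> real s ^ i / fact i * q ^ (s - 1)" if "i < s" for i
  proof -
    have "real ((M choose i) * fact i) \<le> real (M ^ i)"
      unfolding of_nat_le_iff by (rule binomial_fact_pow)
    then have "fact i * real (M choose i) \<le> real M ^ i" by (simp add: mult.commute)
    also have "\<dots> = real s ^ i * q ^ i" by (simp add: assms(2) power_mult_distrib)
    also have "\<dots> \<le> real s ^ i * q ^ (s - 1)"
      using assms(3) that by (intro mult_left_mono power_increasing) auto
    finally show ?thesis by (simp add: field_simps)
  qed
  then have "real (\<Sum>i<s. M choose i) \<le> (\<Sum>i<s. real s ^ i / fact i * q ^ (s - 1))"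
    unfolding of_nat_sum by (intro sum_mono) auto
  also have "\<dots> = (\<Sum>i<s. real s ^ i / fact i) * q ^ (s - 1)" by (simp add: sum_distrib_right)
  also have "(\<Sum>i<s. real s ^ i / fact i) \<le> exp (real s)"
    unfolding exp_def using summable_exp_generic[of "real s"]
    by (auto simp: scaleR_conv_of_real divide_inverse mult.commute intro!: sum_le_suminf)
  finally show ?thesis using assms(3) by (simp add: mult_right_mono)
qed

text \<open>
  The only place where the hypothesis on \<open>n\<close> enters. With \<open>t = k - s\<close> it says that \<open>D ^ k \<le> q ^ t\<close> for
  \<open>D = exp 1 * r ^ 4 * k powr (k / 2)\<close>. The count on the left is at most \<open>D * q ^ (s - 1)\<close>, and the exponents fit
  since \<open>t + (s - 1) * k = s * (k - 1)\<close>. The right-hand side is a \<open>(k - 1)\<close>-st power of \<open>q ^ s\<close>, which in turn is less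
  than the number of \<open>k\<close>-cliques of the extremal graph.
\<close>

lemma nonstar_count_power_le:
  assumes "3 \<le> r" and "r \<le> k" and "k \<le> 2 * r - 2" and "k \<le> n"
    and n: "real n \<ge> real (2 * r - k - 1) *
           (exp 1 * real r ^ 4 * real k powr (real k / 2)) powr (real k / real (2 * k + 1 - 2 * r))
           + real k"
    and s: "s = 2 * r - k - 1" and q: "q = real (n - k) / real s"
  shows "1 \<le> q"
    and "real (2 ^ k * (Suc s * (\<Sum>i<s. (n - k) choose i))) ^ k \<le> q ^ (s * (k - 1))"
proof -
  define t where "t = 2 * k + 1 - 2 * r"
  define D where "D = exp 1 * real r ^ 4 * real k powr (real k / 2)"
  have st: "0 < s" "0 < t" "k = t + s" "s \<le> r - 1" "Suc s \<le> r" using assms(1-3) by (auto simp: s t_def)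
  have k: "0 < k" using assms by simp
  have powr: "real k powr (real k / 2) = sqrt (real k) ^ k"
  proof -
    have "real k powr (real k / 2) = (real k powr (1/2)) powr real k" by (simp add: powr_powr)
    also have "\<dots> = sqrt (real k) ^ k" using k by (simp add: powr_half_sqrt powr_realpow)
    finally show ?thesis .
  qed
  have "sqrt (real k) ^ k \<ge> 1" using k by (intro one_le_power) simp
  moreover have "real r ^ 4 \<ge> 1" using assms(1) by (intro one_le_power) simp
  moreover have "exp 1 \<ge> (1::real)" by simp
  ultimately have D1: "D \<ge> 1" unfolding D_def powr by (metis mult_mono' mult_1 zero_le_one order_trans)
  have "real n \<ge> real s * D powr (real k / real t) + real k"
    using n by (simp add: s t_def D_def)
  then have "real s * D powr (real k / real t) \<le> real (n - k)" using assms(4) by (simp add: of_nat_diff)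
  then have qM: "D powr (real k / real t) \<le> q" using st by (simp add: q field_simps)
  moreover have "1 \<le> D powr (real k / real t)" using D1 by (intro ge_one_powr_ge_zero) auto
  ultimately show q1: "1 \<le> q" by simp
  have "(D powr (real k / real t)) ^ t = D ^ k"
  proof -
    have "(D powr (real k / real t)) ^ t = (D powr (real k / real t)) powr real t"
      using D1 by (subst powr_realpow) auto
    also have "\<dots> = D powr real k" using st by (simp add: powr_powr)
    finally show ?thesis using D1 by (simp add: powr_realpow)
  qed
  then have Dq: "D ^ k \<le> q ^ t" using power_mono[OF qM, of t] by simp
  have "real (2 ^ k * (Suc s * (\<Sum>i<s. (n - k) choose i)))
      = 2 ^ k * (real (Suc s) * real (\<Sum>i<s. (n - k) choose i))"
    by (simp only: of_nat_mult of_nat_power of_nat_numeral)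
  also have "\<dots> \<le> 2 ^ k * (real r * (exp (real s) * q ^ (s - 1)))"
  proof (intro mult_left_mono mult_mono)
    show "real (\<Sum>i<s. (n - k) choose i) \<le> exp (real s) * q ^ (s - 1)"
      by (rule sum_binomial_le[OF st(1) _ q1]) (use st in \<open>simp add: q\<close>)
  qed (use st in \<open>auto intro!: sum_nonneg\<close>)
  also have "\<dots> \<le> 2 ^ k * (real r * (exp (real r - 1) * q ^ (s - 1)))"
    using st q1 by (intro mult_left_mono mult_right_mono) auto
  also have "\<dots> = exp 1 * real r * (2 ^ k * exp (real r - 2)) * q ^ (s - 1)"
  proof -
    have "exp (real r - 1) = exp 1 * exp (real r - 2)" by (simp flip: exp_add)
    then show ?thesis by simp
  qed
  also have "\<dots> \<le> exp 1 * real r * (real r ^ 3 * sqrt (real k) ^ k) * q ^ (s - 1)"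
    using clique_count_constant_le[OF assms(1-3)] q1 by (intro mult_left_mono mult_right_mono) auto
  also have "\<dots> = D * q ^ (s - 1)" unfolding D_def powr by (simp add: eval_nat_numeral)
  finally have "real (2 ^ k * (Suc s * (\<Sum>i<s. (n - k) choose i))) ^ k \<le> (D * q ^ (s - 1)) ^ k"
    by (rule power_mono) (rule of_nat_0_le_iff)
  also have "\<dots> = D ^ k * q ^ ((s - 1) * k)" by (simp add: power_mult_distrib power_mult)
  also have "\<dots> \<le> q ^ t * q ^ ((s - 1) * k)" using Dq q1 by (intro mult_right_mono) auto
  also have "\<dots> = q ^ (s * (k - 1))"
  proof -
    have "t + (s - 1) * k = s * (k - 1)"
      using st by (cases s) (simp_all add: algebra_simps)
    then show ?thesis by (simp flip: power_add)
  qed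
  finally show "real (2 ^ k * (Suc s * (\<Sum>i<s. (n - k) choose i))) ^ k \<le> q ^ (s * (k - 1))" .
qed

section \<open>The extremal graph\<close>

lemma edges_graph_join:
  "{Inl u, Inl v} \<in> edges (graph_join G H) \<longleftrightarrow> {u, v} \<in> edges G"
  "{Inr x, Inr y} \<in> edges (graph_join G H) \<longleftrightarrow> {x, y} \<in> edges H"
  "{Inl u, Inr y} \<in> edges (graph_join G H) \<longleftrightarrow>
     (u \<in> verts G \<and> y \<in> verts H)"
proof -
  have l: "Inl ` S = {Inl u, Inl v} \<longleftrightarrow> S = {u, v}" for S and u v :: 'a
    using inj_image_eq_iff[OF inj_Inl, of S "{u, v}"] by simp
  have r: "Inr ` S = {Inr x, Inr y} \<longleftrightarrow> S = {x, y}" for S and x y :: 'b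
    using inj_image_eq_iff[OF inj_Inr, of S "{x, y}"] by simp
  have l': "{Inl u, Inl v} = Inl ` S \<longleftrightarrow> S = {u, v}" for S and u v :: 'a using l by metis
  have r': "{Inr x, Inr y} = Inr ` S \<longleftrightarrow> S = {x, y}" for S and x y :: 'b using r by metis
  have neq: "{Inl u, Inl v} \<noteq> Inr ` S" "{Inr x, Inr y} \<noteq> Inl ` S'" "{Inl u, Inr y} \<noteq> Inl ` S'"
    "{Inl u, Inr y} \<noteq> Inr ` S" for S :: "'b set" and S' :: "'a set" by auto
  show "{Inl u, Inl v} \<in> edges (graph_join G H) \<longleftrightarrow> {u, v} \<in> edges G"
    using neq by (auto simp: graph_join_def disjoint_union_def image_iff l' doubleton_eq_iff)
  show "{Inr x, Inr y} \<in> edges (graph_join G H) \<longleftrightarrow> {x, y} \<in> edges H"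
    using neq by (auto simp: graph_join_def disjoint_union_def image_iff r' doubleton_eq_iff)
  show "{Inl u, Inr y} \<in> edges (graph_join G H) \<longleftrightarrow> (u \<in> verts G \<and> y \<in> verts H)"
    using neq by (auto simp: graph_join_def disjoint_union_def image_iff doubleton_eq_iff)
qed

lemma card_residue_class:
  assumes "j < s"
  shows "card {x. x < m \<and> x mod s = j} = m div s + (if j < m mod s then 1 else 0)"
proof -
  let ?d = "m div s + (if j < m mod s then 1 else 0)"
  have iff: "i * s + j < m \<longleftrightarrow> i < ?d" for i
  proof -
    have m: "m = (m div s) * s + m mod s" by simp
    have "m mod s < s" using assms by simp
    show ?thesis
    proof (cases "i < m div s")
      case True
      then have "(i + 1) * s \<le> (m div s) * s" by (intro mult_right_mono) auto
      moreover have "(m div s) * s \<le> m" by simp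
      moreover have "(i + 1) * s = i * s + s" by simp
      ultimately have "i * s + j < m" using assms by linarith
      then show ?thesis using True by simp
    next
      case False
      show ?thesis
      proof (cases "i = m div s")
        case True
        then have "i * s = (m div s) * s" by simp
        then have "i * s + j < m \<longleftrightarrow> j < m mod s" using m by (intro iffI; linarith)
        then show ?thesis using True by simp
      next
        case False
        then have "(m div s + 1) * s \<le> i * s" using \<open>\<not> i < m div s\<close> by (intro mult_right_mono) auto
        moreover have "(m div s + 1) * s = (m div s) * s + s" by simp
        ultimately have "m \<le> i * s" using m \<open>m mod s < s\<close> by linarith
        then show ?thesis using False \<open>\<not> i < m div s\<close> by auto
      qed
    qed
  qed
  have "{x. x < m \<and> x mod s = j} = (\<lambda>i. i * s + j) ` {..<?d}"
  proof (intro equalityI subsetI)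
    fix x assume x: "x \<in> {x. x < m \<and> x mod s = j}"
    then have "x = (x div s) * s + j" by (metis (mono_tags, lifting) div_mult_mod_eq mem_Collect_eq)
    then show "x \<in> (\<lambda>i. i * s + j) ` {..<?d}" using iff[of "x div s"] x by auto
  next
    fix x assume "x \<in> (\<lambda>i. i * s + j) ` {..<?d}"
    then obtain i where "i < ?d" "x = i * s + j" by auto
    then show "x \<in> {x. x < m \<and> x mod s = j}" using iff[of i] assms by simp
  qed
  moreover have "inj_on (\<lambda>i. i * s + j) {..<?d}" using assms by (auto simp: inj_on_def)
  ultimately show ?thesis by (simp add: card_image)
qed

text \<open>
  The join of a complete graph and a Turan graph is complete multipartite, the vertices of the
  complete graph being classes of their own. This also holds for \<open>s = 0\<close>, when the second factor has
  no vertices.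
\<close>

lemma join_turan_multipartite:
  fixes t s m :: nat
  defines "H \<equiv> graph_join (complete_graph t) (turan_graph s m)"
    and "c \<equiv> case_sum (\<lambda>i. i) (\<lambda>j. t + j mod s)"
  shows "finite (verts H)"
    and "complete_multipartite (verts H) (edges H) (t + s) c"
    and "i < t + s \<Longrightarrow> card (colour_class (verts H) c i)
           = (if i < t then 1 else m div s + (if i - t < m mod s then 1 else 0))"
proof -
  have V: "verts H = Inl ` {..<t} \<union> Inr ` (if s = 0 then {} else {..<m})"
    by (auto simp: H_def graph_join_def disjoint_union_def complete_graph_def turan_graph_def)
  show "finite (verts H)" unfolding V by simp
  show "complete_multipartite (verts H) (edges H) (t + s) c"
    unfolding complete_multipartite_def
  proof (intro conjI ballI)
    fix u assume u: "u \<in> verts H"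
    show "c u < t + s" using u unfolding V c_def by (auto split: if_splits)
    fix v assume v: "v \<in> verts H"
    have K: "{i, j} \<in> edges (complete_graph t) \<longleftrightarrow> i \<noteq> j" if "i < t" "j < t" for i j
      using that by (auto simp: complete_graph_def nsets_def)
    have T: "{i, j} \<in> edges (turan_graph s m) \<longleftrightarrow> i mod s \<noteq> j mod s" if "i < m" "j < m" "s \<noteq> 0" for i j
      using that by (auto simp: turan_graph_def doubleton_eq_iff)
    have VV: "verts (complete_graph t) = {..<t}" "s \<noteq> 0 \<Longrightarrow> verts (turan_graph s m) = {..<m}"
      by (simp_all add: complete_graph_def turan_graph_def)
    show "({u, v} \<in> edges H) = (c u \<noteq> c v)"
    proof (cases u; cases v)
      fix i j assume "u = Inl i" "v = Inl j"
      then show ?thesis using u v K unfolding V c_def by (auto simp: H_def edges_graph_join)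
    next
      fix i j assume uv: "u = Inl i" "v = Inr j"
      then have "i < t" "j < m" "s \<noteq> 0" using u v unfolding V by (auto split: if_splits)
      then show ?thesis using uv VV by (simp add: H_def c_def edges_graph_join)
    next
      fix i j assume uv: "u = Inr i" "v = Inl j"
      then have "j < t" "i < m" "s \<noteq> 0" using u v unfolding V by (auto split: if_splits)
      then show ?thesis using uv VV by (simp add: H_def c_def edges_graph_join insert_commute[of "Inr i"])
    next
      fix i j assume uv: "u = Inr i" "v = Inr j"
      then have "j < m" "i < m" "s \<noteq> 0" using u v unfolding V by (auto split: if_splits)
      then show ?thesis using uv T by (simp add: H_def c_def edges_graph_join)
    qed
  qed
  show "card (colour_class (verts H) c i)
           = (if i < t then 1 else m div s + (if i - t < m mod s then 1 else 0))" if i: "i < t + s"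
  proof (cases "i < t")
    case True
    then have "colour_class (verts H) c i = {Inl i}" unfolding V c_def by auto
    then show ?thesis using True by simp
  next
    case False
    then have j: "i - t < s" "s \<noteq> 0" using i by auto
    have "colour_class (verts H) c i = Inr ` {x. x < m \<and> x mod s = i - t}"
      using False j unfolding V c_def by auto
    then show ?thesis using False card_residue_class[OF j(1)] by (simp add: card_image)
  qed
qed

lemma prod_if_less:
  fixes x y :: nat
  assumes "b \<le> s"
  shows "(\<Prod>j<s. if j < b then x else y) = y ^ (s - b) * x ^ b"
proof -
  have "{..<s} = {..<b} \<union> {b..<s}" using assms by auto
  then have "(\<Prod>j<s. if j < b then x else y) = (\<Prod>j<b. if j < b then x else y) * (\<Prod>j\<in>{b..<s}. if j < b then x else y)"
    by (simp add: prod.union_disjoint ivl_disj_int)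
  then show ?thesis by (simp add: mult.commute)
qed

lemma prod_split_at:
  fixes f :: "nat \<Rightarrow> 'b :: comm_monoid_mult"
  shows "(\<Prod>i<t + s. f i) = (\<Prod>i<t. f i) * (\<Prod>j<s. f (t + j))"
  by (induction s) (simp_all add: mult.assoc)

lemma clique_spectral_radius_join_turan:
  assumes "3 \<le> t + s" and "0 < s \<Longrightarrow> 0 < m div s"
  shows "clique_spectral_radius (t + s) (graph_join (complete_graph t) (turan_graph s m)) ^ (t + s)
       = real (balanced_product s m) ^ (t + s - 1)"
proof -
  let ?H = "graph_join (complete_graph t) (turan_graph s m)"
  let ?c = "case_sum (\<lambda>i. i) (\<lambda>j. t + j mod s)"
  note H = join_turan_multipartite[where t = t and s = s and m = m]
  have card_pos: "card (colour_class (verts ?H) ?c i) > 0" if "i < t + s" for i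
  proof (cases "i < t")
    case True then show ?thesis using H(3)[of i] that by simp
  next
    case False
    then have "0 < s" using that by simp
    then show ?thesis using H(3)[of i] that False assms(2) by simp
  qed
  then have ne: "colour_class (verts ?H) ?c i \<noteq> {}" if "i < t + s" for i
    using card_pos[OF that] by (metis card.empty less_irrefl)
  have "(\<Prod>i<t + s. card (colour_class (verts ?H) ?c i))
      = (\<Prod>i<t + s. if i < t then 1 else m div s + (if i - t < m mod s then 1 else 0))"
    using H(3) by (intro prod.cong) auto
  also have "\<dots> = (\<Prod>j<s. if j < m mod s then m div s + 1 else m div s)"
    by (subst prod_split_at) (auto intro!: prod.cong)
  also have "\<dots> = balanced_product s m"
  proof (cases "s = 0")
    case True then show ?thesis by (simp add: balanced_product_def)
  next
    case False
    then show ?thesis by (subst prod_if_less) (simp_all add: balanced_product_def less_imp_le)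
  qed
  finally have "(\<Prod>i<t + s. real (card (colour_class (verts ?H) ?c i))) = real (balanced_product s m)"
    by (simp flip: of_nat_prod)
  then show ?thesis
    using clique_spectral_radius_multipartite[OF H(1) assms(1) H(2) ne] by simp
qed

text \<open>
  Since the class sizes are \<open>a\<close> or \<open>a + 1\<close> and add up to \<open>m\<close>, exactly \<open>m mod s\<close> of them are large. In the
  Turan graph the large classes are the residues below \<open>m mod s\<close>, and \<open>\<tau>\<close> matches large classes with
  large ones.
\<close>

lemma graph_iso_join_turan:
  assumes "finite (verts G)" and simple: "\<And>u. {u} \<notin> edges G" and T: "T \<subseteq> verts G" and "0 < s"
    and mp: "complete_multipartite (verts G - T) (edges G) s c"
    and sizes: "\<And>i. i < s \<Longrightarrow> card (colour_class (verts G - T) c i)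
                  \<in> {card (verts G - T) div s, card (verts G - T) div s + 1}"
    and clT: "clique T (edges G)" and join: "\<And>u w. u \<in> T \<Longrightarrow> w \<in> verts G - T \<Longrightarrow> {u, w} \<in> edges G"
  shows "graph_iso G (graph_join (complete_graph (card T)) (turan_graph s (card (verts G - T))))"
proof -
  let ?V = "verts G" let ?W = "?V - T" let ?t = "card T"
  define m where "m = card ?W"
  let ?H = "graph_join (complete_graph ?t) (turan_graph s m)"
  let ?cH = "case_sum (\<lambda>i. i) (\<lambda>j. ?t + j mod s)"
  note H = join_turan_multipartite[where t = ?t and s = s and m = m]
  have fin: "finite T" "finite ?W" using assms(1) T by (auto intro: finite_subset)
  obtain e where e: "bij_betw e T {..<?t}"
    using ex_bij_betw_finite_nat[OF fin(1)] by (auto simp: atLeast0LessThan)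
  define cG where "cG v = (if v \<in> T then e v else ?t + c v)" for v
  have eT: "e v < ?t" if "v \<in> T" for v using bij_betwE[OF e] that by auto
  have cs: "c v < s" if "v \<in> ?W" for v using mp that by (simp add: complete_multipartite_def)
  have mpG: "complete_multipartite ?V (edges G) (?t + s) cG"
    unfolding complete_multipartite_def
  proof (intro conjI ballI)
    fix u assume u: "u \<in> ?V"
    show "cG u < ?t + s" using eT[of u] cs[of u] u by (auto simp: cG_def)
    fix v assume v: "v \<in> ?V"
    consider "u \<in> T" "v \<in> T" | "u \<in> T" "v \<in> ?W" | "u \<in> ?W" "v \<in> T" | "u \<in> ?W" "v \<in> ?W"
      using u v by blast
    then show "({u, v} \<in> edges G) = (cG u \<noteq> cG v)"
    proof cases
      case 1
      then have "cG u = cG v \<longleftrightarrow> u = v" using e by (auto simp: cG_def bij_betw_def inj_on_def)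
      then show ?thesis using 1 clT simple by (auto simp: clique_def)
    next
      case 2
      then show ?thesis using join[OF 2] eT[OF 2(1)] by (simp add: cG_def)
    next
      case 3
      then show ?thesis using join[OF 3(2,1)] eT[OF 3(2)] by (simp add: cG_def insert_commute)
    next
      case 4
      then show ?thesis using mp by (simp add: cG_def complete_multipartite_def)
    qed
  qed
  have classT: "card (colour_class ?V cG i) = 1" if i: "i < ?t" for i
  proof -
    have "i \<in> e ` T" using e i by (auto simp: bij_betw_def)
    then obtain v where v: "v \<in> T" "e v = i" by auto
    have "colour_class ?V cG i = {v}"
      using v T e i by (auto simp: cG_def bij_betw_def inj_on_def split: if_splits)
    then show ?thesis by simp
  qed
  have classW: "colour_class ?V cG (?t + j) = colour_class ?W c j" for j
  proof -
    have "cG v = ?t + j \<longleftrightarrow> v \<notin> T \<and> c v = j" for v using eT[of v] by (auto simp: cG_def)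
    then show ?thesis by auto
  qed
  define L where "L = {j. j < s \<and> card (colour_class ?W c j) = m div s + 1}"
  have finL: "finite L" and Ls: "L \<subseteq> {..<s}" by (auto simp: L_def)
  have size: "card (colour_class ?W c j) = m div s + (if j \<in> L then 1 else 0)" if "j < s" for j
    using sizes[OF that] that by (auto simp: L_def m_def)
  have "m = (\<Sum>j<s. card (colour_class ?W c j))"
    using sum_colour_classes[OF fin(2) cs] by (simp add: m_def)
  also have "\<dots> = (\<Sum>j<s. m div s + (if j \<in> L then 1 else 0))" using size by (intro sum.cong) auto
  also have "\<dots> = s * (m div s) + card L"
  proof -
    have "(\<Sum>j<s. if j \<in> L then 1 else 0 :: nat) = card ({..<s} \<inter> L)" by (simp add: sum.If_cases)
    then show ?thesis using Ls by (simp add: sum.distrib Int_absorb1)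
  qed
  finally have cardL: "card L = m mod s" by (metis add_left_cancel mult_div_mod_eq)
  have b: "m mod s < s" using assms(4) by simp
  obtain f where f: "bij_betw f L {..<m mod s}"
    using finite_same_card_bij[OF finL, of "{..<m mod s}"] cardL by auto
  obtain g where g: "bij_betw g ({..<s} - L) ({..<s} - {..<m mod s})"
    using finite_same_card_bij[of "{..<s} - L" "{..<s} - {..<m mod s}"] Ls finL cardL b
    by (auto simp: card_Diff_subset)
  define \<tau> where "\<tau> j = (if j \<in> L then f j else g j)" for j
  have f_in: "f j < m mod s" if "j \<in> L" for j using bij_betwE[OF f] that by auto
  have g_in: "g j < s \<and> \<not> g j < m mod s" if "j < s" "j \<notin> L" for j
  proof -
    have "g j \<in> {..<s} - {..<m mod s}" using bij_betwE[OF g] that by blast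
    then show ?thesis by simp
  qed
  have \<tau>L: "\<tau> j < m mod s \<longleftrightarrow> j \<in> L" if "j < s" for j
    using f_in[of j] g_in[of j] that by (auto simp: \<tau>_def)
  have \<tau>s: "\<tau> j < s" if "j < s" for j
    using less_trans[OF f_in[of j] b] g_in[of j] that by (auto simp: \<tau>_def)
  have \<tau>inj: "i = j" if "i < s" "j < s" "\<tau> i = \<tau> j" for i j
  proof -
    have "i \<in> L \<longleftrightarrow> j \<in> L" using \<tau>L that by metis
    then show ?thesis
      using that f g by (auto simp: \<tau>_def bij_betw_def inj_on_def split: if_splits)
  qed
  define \<sigma> where "\<sigma> i = (if i < ?t then i else ?t + \<tau> (i - ?t))" for i
  have \<sigma>: "bij_betw \<sigma> {..<?t + s} {..<?t + s}"
  proof -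
    have maps: "\<sigma> ` {..<?t + s} \<subseteq> {..<?t + s}"
    proof (rule image_subsetI)
      fix i assume "i \<in> {..<?t + s}"
      then show "\<sigma> i \<in> {..<?t + s}" using \<tau>s[of "i - ?t"] by (auto simp: \<sigma>_def)
    qed
    have inj: "inj_on \<sigma> {..<?t + s}"
    proof (rule inj_onI)
      fix i j assume ij: "i \<in> {..<?t + s}" "j \<in> {..<?t + s}" "\<sigma> i = \<sigma> j"
      show "i = j"
      proof (cases "i < ?t \<or> j < ?t")
        case True then show ?thesis using ij by (auto simp: \<sigma>_def split: if_splits)
      next
        case False
        then have "\<tau> (i - ?t) = \<tau> (j - ?t)" using ij(3) by (simp add: \<sigma>_def)
        moreover have "i - ?t < s" "j - ?t < s" using False ij(1,2) by auto
        ultimately have "i - ?t = j - ?t" using \<tau>inj by blast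
        then show ?thesis using False by linarith
      qed
    qed
    show ?thesis using endo_inj_surj[OF _ maps inj] inj by (simp add: bij_betw_def)
  qed
  have "card (colour_class ?V cG i) = card (colour_class (verts ?H) ?cH (\<sigma> i))" if i: "i < ?t + s" for i
  proof (cases "i < ?t")
    case True
    then show ?thesis using classT H(3)[of i] by (simp add: \<sigma>_def)
  next
    case False
    define j where "j = i - ?t"
    have j: "i = ?t + j" "j < s" using False i by (auto simp: j_def)
    have "card (colour_class ?V cG i) = m div s + (if j \<in> L then 1 else 0)"
      using size[OF j(2)] by (simp only: j(1) classW)
    moreover have "\<sigma> i = ?t + \<tau> j" using j by (simp add: \<sigma>_def)
    moreover have "card (colour_class (verts ?H) ?cH (?t + \<tau> j)) = m div s + (if \<tau> j < m mod s then 1 else 0)"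
      using H(3)[of "?t + \<tau> j"] \<tau>s[OF j(2)] by simp
    ultimately show ?thesis using \<tau>L[OF j(2)] by simp
  qed
  then show ?thesis
    using graph_iso_multipartite[OF assms(1) H(1) mpG H(2) \<sigma>] by (simp add: m_def)
qed

lemma sum_spectral_radii_multipartite:
  assumes "finite (verts G)" and "3 \<le> k" and mp: "complete_multipartite (verts G) (edges G) k c"
    and ne: "\<And>i. i < k \<Longrightarrow> colour_class (verts G) c i \<noteq> {}" and "k \<le> l"
  shows "(\<Sum>p = k..l. clique_spectral_radius p G) = clique_spectral_radius k G"
proof -
  have "verts G \<noteq> {}" using ne[of 0] assms(2) by auto
  have "clique_spectral_radius p G = 0" if "p \<in> {Suc k..l}" for p
  proof -
    have "cliques p G = {}"
      using multipartite_no_larger_cliques[OF assms(1) mp, of p] that by (simp add: cliques_eq_cliques_on)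
    then show ?thesis
      using clique_spectral_radius_le_card[OF assms(1) \<open>verts G \<noteq> {}\<close>, of p]
        clique_spectral_radius_nonneg[OF assms(1) \<open>verts G \<noteq> {}\<close>, of p] that assms(2) by simp
  qed
  then have "(\<Sum>p = Suc k..l. clique_spectral_radius p G) = 0" by (intro sum.neutral) auto
  then show ?thesis using assms(5) by (simp add: sum.atLeast_Suc_atMost)
qed

text \<open>
  A complete multipartite structure and its class sizes are carried over by the isomorphism, and
  they determine the spectral radius.
\<close>

lemma spectral_radius_iso_join_turan:
  assumes "finite (verts G)" and "3 \<le> t + s" and "0 < m div s" and "t + s \<le> l"
    and iso: "graph_iso G (graph_join (complete_graph t) (turan_graph s m))"
  shows "(\<Sum>p = t + s..l. clique_spectral_radius p G)
       = clique_spectral_radius (t + s) (graph_join (complete_graph t) (turan_graph s m))"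
proof -
  let ?H = "graph_join (complete_graph t) (turan_graph s m)"
  let ?c = "case_sum (\<lambda>i. i) (\<lambda>j. t + j mod s)"
  note H = join_turan_multipartite[where t = t and s = s and m = m]
  obtain f where f: "complete_multipartite (verts G) (edges G) (t + s) (?c \<circ> f)"
    "\<And>i. card (colour_class (verts G) (?c \<circ> f) i) = card (colour_class (verts ?H) ?c i)"
    using multipartite_of_graph_iso[OF iso H(2)] by (elim exE conjE) (rule that, assumption, erule spec)
  have ne: "colour_class (verts G) (?c \<circ> f) i \<noteq> {}" "colour_class (verts ?H) ?c i \<noteq> {}" if "i < t + s" for i
  proof -
    have "card (colour_class (verts ?H) ?c i) > 0" using H(3)[OF that] assms(3) by simp
    then show "colour_class (verts G) (?c \<circ> f) i \<noteq> {}" "colour_class (verts ?H) ?c i \<noteq> {}"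
      using f(2)[of i] by (metis card.empty less_irrefl)+
  qed
  have "0 < t + s" using assms(2) by linarith
  then have nonempty: "verts G \<noteq> {}" "verts ?H \<noteq> {}" using ne[of 0] by blast+
  have "clique_spectral_radius (t + s) G ^ (t + s) = clique_spectral_radius (t + s) ?H ^ (t + s)"
    using clique_spectral_radius_multipartite[OF assms(1,2) f(1) ne(1)]
      clique_spectral_radius_multipartite[OF H(1) assms(2) H(2) ne(2)] f(2) by simp
  then have "clique_spectral_radius (t + s) G = clique_spectral_radius (t + s) ?H"
    using clique_spectral_radius_nonneg[OF assms(1) nonempty(1) assms(2)]
      clique_spectral_radius_nonneg[OF H(1) nonempty(2) assms(2)] \<open>0 < t + s\<close>
    by (rule power_eq_imp_eq_base)
  then show ?thesis
    using sum_spectral_radii_multipartite[OF assms(1,2) f(1) ne(1) assms(4)] by simp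
qed

section \<open>Comparison with the extremal graph\<close>

text \<open>
  The degenerate case \<open>k = 2 * r - 1\<close>: a single \<open>k\<close>-clique is a complete \<open>k\<close>-partite graph with
  singleton classes and has spectral radius \<open>1\<close>.
\<close>

lemma clique_spectral_radius_at_most_one_clique:
  assumes fin: "finite (verts G)" and "verts G \<noteq> {}" and "3 \<le> k"
    and loopless: "\<And>u. {u} \<notin> edges G" and C: "card (cliques k G) \<le> 1"
  shows "clique_spectral_radius k G \<le> 1"
    and "clique_spectral_radius k G = 1 \<longleftrightarrow> card (cliques k G) = 1"
proof -
  note le = clique_spectral_radius_le_card[OF assms(1-3)]
  show "clique_spectral_radius k G \<le> 1" using le C by linarith
  have "1 \<le> clique_spectral_radius k G" if "card (cliques k G) = 1"
  proof -
    obtain K where K: "cliques k G = {K}" using \<open>card (cliques k G) = 1\<close> by (auto simp: card_1_singleton_iff)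
    then have Kd: "K \<subseteq> verts G" "finite K" "card K = k" "clique K (edges G)"
      using cliques_onD[of K k "verts G" "edges G"] by (auto simp: cliques_eq_cliques_on)
    obtain e where e: "bij_betw e K {..<k}"
      using ex_bij_betw_finite_nat[OF Kd(2)] Kd(3) by (auto simp: atLeast0LessThan)
    have "complete_multipartite K (edges G) k e"
      unfolding complete_multipartite_def
    proof (intro conjI ballI)
      fix u v assume "u \<in> K" "v \<in> K"
      then show "({u, v} \<in> edges G) = (e u \<noteq> e v)"
        using Kd(4) loopless e by (cases "u = v") (auto simp: clique_def bij_betw_def inj_on_def)
    qed (use bij_betwE[OF e] in auto)
    moreover have class1: "card (colour_class K e i) = 1" if i: "i < k" for i
    proof -
      have "i \<in> e ` K" using e i by (auto simp: bij_betw_def)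
      then obtain v where "v \<in> K" "e v = i" by auto
      then have "colour_class K e i = {v}" using e by (auto simp: bij_betw_def inj_on_def)
      then show ?thesis by simp
    qed
    moreover have "colour_class K e i \<noteq> {}" if i: "i < k" for i
      using class1[OF i] by (metis card.empty zero_neq_one)
    ultimately have "(\<Prod>i<k. real (card (colour_class K e i))) ^ (k - 1) \<le> clique_spectral_radius k G ^ k"
      using K by (intro clique_spectral_radius_multipartite_ge[OF fin assms(3) Kd(1)]) auto
    moreover have "(\<Prod>i<k. real (card (colour_class K e i))) = 1"
      using class1 by (intro prod.neutral) auto
    ultimately have "1 ^ k \<le> clique_spectral_radius k G ^ k" by simp
    then show ?thesis
      using clique_spectral_radius_nonneg[OF assms(1-3)] assms(3)
        power_le_imp_le_base[of 1 "k - 1" "clique_spectral_radius k G"] by simp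
  qed
  then show "clique_spectral_radius k G = 1 \<longleftrightarrow> card (cliques k G) = 1"
    using le C by auto
qed

lemma card_sum_cliques:
  assumes "finite (verts G)"
  shows "(\<Sum>p = k..l. card (cliques p G)) = card (\<Union>p\<in>{k..l}. cliques p G)"
  using assms
  by (intro card_UN_disjoint[symmetric]) (auto simp: cliques_eq_cliques_on cliques_on_def)

text \<open>
  When no kernel of size \<open>k - s\<close> is common to all \<open>k\<close>-cliques, even the crude bound of each spectral
  radius by the number of cliques suffices. All clique sizes are counted together, as one family; its
  members need not have the same size.
\<close>

lemma nonstar_sum_spectral_radii_le:
  assumes fin: "finite (verts G)" and "3 \<le> k" and "0 < s" and "s \<le> k"
    and union: "\<And>p p' X Y. k \<le> p \<Longrightarrow> k \<le> p' \<Longrightarrow> X \<in> cliques p G \<Longrightarrow> Y \<in> cliques p' G \<Longrightarrow>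
                  card (X \<union> Y) \<le> k + s"
    and nonstar: "\<And>T. T \<subseteq> verts G \<Longrightarrow> card T = k - s \<Longrightarrow> \<exists>K\<in>cliques k G. \<not> T \<subseteq> K"
    and ne: "cliques k G \<noteq> {}"
  shows "(\<Sum>p = k..k + s. clique_spectral_radius p G)
       \<le> real (2 ^ k * (Suc s * (\<Sum>i<s. (card (verts G) - k) choose i)))"
proof -
  let ?V = "verts G" let ?E = "edges G"
  define F where "F = (\<Union>p\<in>{k..k + s}. cliques p G)"
  have cl: "K \<subseteq> ?V" "finite K" "card K = p" "clique K ?E" if "K \<in> cliques p G" for K p
    using that by (auto simp: cliques_eq_cliques_on dest: cliques_onD)
  have "?V \<noteq> {}" using ne cl(1,3) assms(2) by fastforce
  have subclique: "S \<in> cliques (card S) G" if "K \<in> cliques p G" "S \<subseteq> K" for K p S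
    using cl[OF that(1)] that(2) clique_subset[OF _ that(2), of ?E] finite_subset[OF that(2)]
    by (auto simp: cliques_eq_cliques_on cliques_on_def)
  have larger: "\<exists>B. B \<in> cliques (Suc k) G \<and> B \<subseteq> K" if "K \<in> cliques p G" "k < p" for K p
  proof -
    have "Suc k \<le> card K" using cl(3)[OF that(1)] that(2) by simp
    then obtain B where "B \<subseteq> K" "card B = Suc k" by (meson obtain_subset_with_card_n)
    then show ?thesis using subclique[OF that(1), of B] by auto
  qed
  have unionF: "card (X \<union> Y) \<le> k + s" if "X \<in> F" "Y \<in> F" for X Y
    using that union by (auto simp: F_def)
  have FV: "X \<subseteq> ?V" if "X \<in> F" for X using that cl by (auto simp: F_def)
  have kF: "cliques k G \<subseteq> F" unfolding F_def by (intro UN_upper) simp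
  have card_F: "card F \<le> 2 ^ k * (Suc s * (\<Sum>i<s. (card ?V - k) choose i))"
  proof (cases "cliques (Suc k) G = {}")
    case True
    obtain A where A: "A \<in> cliques k G" using ne by auto
    have "\<forall>X\<in>F. card X = k"
    proof
      fix X assume "X \<in> F"
      then obtain p where "k \<le> p" "X \<in> cliques p G" by (auto simp: F_def)
      then show "card X = k" using larger[of X p] True cl(3)[of X p] by (cases "k = p") auto
    qed
    moreover have "\<exists>C\<in>F. \<not> T \<subseteq> C" if "T \<subseteq> A" "card T = k - s" for T
      using nonstar[of T] that cl(1)[OF A] kF by blast
    ultimately show ?thesis
      using A kF cl[OF A] by (intro card_nonstar_family[where A = A, OF fin FV _ _ assms(3,4) _ unionF]) auto
  next
    case False
    then obtain B where B: "B \<in> cliques (Suc k) G" by auto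
    have "k \<le> card B" using cl(3)[OF B] by simp
    then obtain A where "A \<subseteq> B" "card A = k" by (meson obtain_subset_with_card_n)
    moreover from this have A: "A \<in> cliques k G" using subclique[OF B] by auto
    moreover have "B \<in> F" using B assms(3) by (auto simp: F_def)
    ultimately show ?thesis
      using kF cl[OF A] cl(3)[OF B] by (intro card_nonstar_family[where A = A, OF fin FV _ _ assms(3,4) _ unionF]) auto
  qed
  have "(\<Sum>p = k..k + s. clique_spectral_radius p G) \<le> (\<Sum>p = k..k + s. real (card (cliques p G)))"
    using clique_spectral_radius_le_card[OF fin \<open>?V \<noteq> {}\<close>] assms(2) by (intro sum_mono) auto
  also have "\<dots> = real (card F)" using card_sum_cliques[OF fin, of k "k + s"] by (simp add: F_def flip: of_nat_sum)
  also have "\<dots> \<le> real (2 ^ k * (Suc s * (\<Sum>i<s. (card ?V - k) choose i)))"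
    using card_F by (simp only: of_nat_le_iff)
  finally show ?thesis .
qed

theorem theorem1p7:
  fixes r k n :: nat and G :: "'a sgraph"
  assumes "3 \<le> r" and "r \<le> k" and "k \<le> 2 * r - 1"
    and "real n \<ge> real (2 * r - k - 1) *
           (exp 1 * real r ^ 4 * real k powr (real k / 2)) powr (real k / real (2 * k + 1 - 2 * r))
           + real k"
    and "simple_graph G" and "card (verts G) = n"
    and "\<not> contains_subgraph G (disjoint_union (complete_graph r) (complete_graph r))"
  shows "(\<Sum>s = k..2 * r - 1. clique_spectral_radius s G)
           \<le> clique_spectral_radius k
               (graph_join (complete_graph (2 * k + 1 - 2 * r))
                     (turan_graph (2 * r - k - 1) (n + 2 * r - 1 - 2 * k)))
       \<and> (k = 2 * r - 1 \<longrightarrow>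
            ((\<Sum>s = k..2 * r - 1. clique_spectral_radius s G)
               = clique_spectral_radius k
                   (graph_join (complete_graph (2 * k + 1 - 2 * r))
                         (turan_graph (2 * r - k - 1) (n + 2 * r - 1 - 2 * k)))
             \<longleftrightarrow> card (cliques k G) = 1))
       \<and> (k \<le> 2 * r - 2 \<longrightarrow>
            ((\<Sum>s = k..2 * r - 1. clique_spectral_radius s G)
               = clique_spectral_radius k
                   (graph_join (complete_graph (2 * k + 1 - 2 * r))
                         (turan_graph (2 * r - k - 1) (n + 2 * r - 1 - 2 * k)))
             \<longleftrightarrow> graph_iso G
                   (graph_join (complete_graph (2 * k + 1 - 2 * r))
                         (turan_graph (2 * r - k - 1) (n + 2 * r - 1 - 2 * k)))))"
proof -
  define t where "t = 2 * k + 1 - 2 * r"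
  define s where "s = 2 * r - k - 1"
  define m where "m = n + 2 * r - 1 - 2 * k"
  define H where "H = graph_join (complete_graph t) (turan_graph s m)"
  let ?V = "verts G" let ?E = "edges G"
  define S where "S = (\<Sum>p = k..k + s. clique_spectral_radius p G)"
  have k: "k = t + s" "0 < t" "k + s = 2 * r - 1" "3 \<le> k" "s \<le> k" "k - s = t"
    using assms(1-3) by (auto simp: t_def s_def)
  have "real k \<le> real n"
    using assms(4) by (smt (verit) mult_nonneg_nonneg of_nat_0_le_iff powr_ge_zero)
  then have kn: "k \<le> n" by simp
  have m: "m + t = n" using kn assms(1-3) by (simp add: m_def t_def)
  have fin: "finite ?V" and edges: "?E \<subseteq> [?V]\<^bsup>2\<^esup>" using assms(5) by (auto simp: simple_graph_def)
  have loopless: "{u} \<notin> ?E" for u using edges by (auto simp: nsets_def)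
  have neV: "?V \<noteq> {}" using assms(6) kn k(4) by auto
  have union: "card (X \<union> Y) \<le> k + s"
    if "k \<le> p" "k \<le> p'" "X \<in> cliques p G" "Y \<in> cliques p' G" for p p' X Y
  proof (rule ccontr)
    assume "\<not> card (X \<union> Y) \<le> k + s"
    then have "2 * r \<le> card (X \<union> Y)" using k(3) assms(1) by simp
    then show False
      using two_disjoint_cliques_contained[OF that(3,4), of r] that(1,2) assms(2,7) by simp
  qed
  have H_nonneg: "0 \<le> clique_spectral_radius k H"
  proof (rule clique_spectral_radius_nonneg[OF _ _ k(4)])
    show "finite (verts H)" unfolding H_def by (rule join_turan_multipartite(1))
    have "Inl 0 \<in> verts H" using k(2)
      by (auto simp: H_def graph_join_def disjoint_union_def complete_graph_def)
    then show "verts H \<noteq> {}" by auto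
  qed
  have H_power: "clique_spectral_radius k H ^ k = real (balanced_product s m) ^ (k - 1)"
    if "0 < s \<Longrightarrow> 0 < m div s"
    using clique_spectral_radius_join_turan[of t s m] k that unfolding H_def by simp
  (* For s = 0 the quotient m div s is 0, and the extremal graph is a single clique. *)
  have main: "S \<le> clique_spectral_radius k H \<and>
      (k = 2 * r - 1 \<longrightarrow> (S = clique_spectral_radius k H \<longleftrightarrow> card (cliques k G) = 1)) \<and>
      (k \<le> 2 * r - 2 \<longrightarrow> (S = clique_spectral_radius k H \<longleftrightarrow> graph_iso G H))"
  proof (cases "s = 0")
    case True
    have "clique_spectral_radius k H ^ k = 1"
      using H_power True by (simp add: balanced_product_def)
    then have H1: "clique_spectral_radius k H = 1"
      using power_eq_imp_eq_base[of "clique_spectral_radius k H" k 1] H_nonneg k(4) by simp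
    have "X = Y" if XY: "X \<in> cliques k G" "Y \<in> cliques k G" for X Y
    proof -
      have X: "finite X" "card X = k" and Y: "finite Y" "card Y = k"
        using XY by (auto simp: cliques_eq_cliques_on dest: cliques_onD)
      have "card (X \<union> Y) \<le> k" using union[OF _ _ XY] True by simp
      then have "X = X \<union> Y" using X Y by (intro card_seteq) auto
      moreover have "Y = X \<union> Y" using X Y \<open>card (X \<union> Y) \<le> k\<close> by (intro card_seteq) auto
      ultimately show ?thesis by simp
    qed
    then have "card (cliques k G) \<le> 1"
      by (metis One_nat_def card_le_Suc0_iff_eq fin finite_cliques_on cliques_eq_cliques_on)
    note * = clique_spectral_radius_at_most_one_clique[OF fin neV k(4) loopless this]
    have "S = clique_spectral_radius k G" using True by (simp add: S_def)
    then show ?thesis using * H1 True k assms(1) by auto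
  next
    case False
    then have s: "0 < s" by simp
    then have kr: "k \<le> 2 * r - 2" using k by simp
    define q where "q = real (n - k) / real s"
    note q = nonstar_count_power_le[OF assms(1,2) kr kn assms(4) s_def q_def]
    have "s * (m div s) + m mod s = m" "m mod s < s" using s by auto
    (* Here n - k = m - s, and m - s is less than the largest multiple of s up to m. *)
    then have "n - k < s * (m div s)" using m k kn by linarith
    then have "real (n - k) < real s * real (m div s)" by (metis of_nat_less_iff of_nat_mult)
    then have qa: "q < real (m div s)" using s by (simp add: q_def field_simps)
    then have "0 < real (m div s)" using q(1) by linarith
    then have pos: "0 < m div s" by simp
    let ?P = "balanced_product s m"
    have HP: "clique_spectral_radius k H ^ k = real ?P ^ (k - 1)" using H_power pos by simp
    have Ppos: "0 < ?P" using pos by (simp add: balanced_product_def)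
    have strict: "S < clique_spectral_radius k H" if "S ^ k < real ?P ^ (k - 1)"
      using that H_nonneg HP power_less_imp_less_base by metis
    have iso: "S = clique_spectral_radius k H" if "graph_iso G H"
      using spectral_radius_iso_join_turan[OF fin, of t s m "k + s"] that k pos
      by (simp add: S_def H_def)
    have "S < clique_spectral_radius k H \<or> (S \<le> clique_spectral_radius k H \<and>
        (S = clique_spectral_radius k H \<longrightarrow> graph_iso G H))"
    (* If there are no k-cliques at all, any T serves as a kernel. *)
    proof (cases "\<exists>T\<subseteq>?V. card T = t \<and> (\<forall>K\<in>cliques k G. T \<subseteq> K)")
      case True
      then obtain T where T: "T \<subseteq> ?V" "card T = t" and star: "\<And>K. K \<in> cliques k G \<Longrightarrow> T \<subseteq> K" by blast
      have neT: "T \<noteq> {}" using T(2) k(2) by auto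
      have finT: "finite T" using T(1) fin by (rule finite_subset)
      have cW: "card (?V - T) = m" using T finT m assms(6) by (simp add: card_Diff_subset)
      have larger: "cliques p G = {}" if "k < p" for p
        unfolding cliques_eq_cliques_on
        by (rule star_no_larger_cliques[OF fin neT _ that]) (use star in \<open>simp add: cliques_eq_cliques_on\<close>)
      have "clique_spectral_radius p G = 0" if "p \<in> {Suc k..k + s}" for p
        using clique_spectral_radius_le_card[OF fin neV, of p] clique_spectral_radius_nonneg[OF fin neV, of p]
          larger[of p] that k(4) by simp
      then have "(\<Sum>p = Suc k..k + s. clique_spectral_radius p G) = 0" by (intro sum.neutral) auto
      then have S: "S = clique_spectral_radius k G" by (simp add: S_def sum.atLeast_Suc_atMost)
      have le: "S ^ k \<le> real (card (cliques k G)) ^ (k - 1)"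
        using clique_spectral_radius_power_le[OF fin neV k(4)] larger S by simp
      have Ck: "cliques k G = cliques_on (card T + s) ?V ?E" using k(1) T(2) by (simp add: cliques_eq_cliques_on)
      have star': "\<And>K. K \<in> cliques_on (card T + s) ?V ?E \<Longrightarrow> T \<subseteq> K" using star Ck by simp
      have pos': "0 < card (?V - T) div s" using pos cW by simp
      have CP: "card (cliques k G) \<le> ?P"
        using card_star_cliques_le[OF fin loopless T(1) neT s star' pos'] by (simp add: Ck cW)
      then have "S ^ k \<le> clique_spectral_radius k H ^ k"
        unfolding HP by (intro order_trans[OF le] power_mono) auto
      then have "S \<le> clique_spectral_radius k H"
        using power_le_imp_le_base[of S "k - 1" "clique_spectral_radius k H"] H_nonneg k(4) by simp
      moreover have "graph_iso G H" if "S = clique_spectral_radius k H"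
      proof -
        have "real ?P ^ (k - 1) \<le> real (card (cliques k G)) ^ (k - 1)" using that le HP by simp
        then have "real ?P \<le> real (card (cliques k G))"
          using k(4) by (subst (asm) power_mono_iff) auto
        then have "card (cliques k G) = ?P" using CP by simp
        then obtain c where c: "complete_multipartite (?V - T) ?E s c"
           "\<forall>i<s. card (colour_class (?V - T) c i) \<in> {card (?V - T) div s, card (?V - T) div s + 1}"
           "clique T ?E" "\<forall>u\<in>T. \<forall>w\<in>?V - T. {u, w} \<in> ?E"
          using star_cliques_extremal[OF fin loopless T(1) neT s star' pos'] by (auto simp: Ck cW)
        have "graph_iso G (graph_join (complete_graph (card T)) (turan_graph s (card (?V - T))))"
          using c by (intro graph_iso_join_turan[OF fin loopless T(1) s c(1)]) auto
        then show ?thesis by (simp add: H_def cW T(2))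
      qed
      ultimately show ?thesis by blast
    next
      case False
      have ne: "cliques k G \<noteq> {}"
      proof
        assume "cliques k G = {}"
        moreover obtain T where "T \<subseteq> ?V" "card T = t"
          using obtain_subset_with_card_n[of t ?V] m assms(6) by auto
        ultimately show False using False by auto
      qed
      have "S ^ k < real ?P ^ (k - 1)"
      proof -
        have "S \<le> real (2 ^ k * (Suc s * (\<Sum>i<s. (card ?V - k) choose i)))"
          unfolding S_def
        proof (rule nonstar_sum_spectral_radii_le[OF fin k(4) s k(5) union _ ne])
          fix T assume "T \<subseteq> ?V" "card T = k - s"
          then show "\<exists>K\<in>cliques k G. \<not> T \<subseteq> K" using False unfolding k(6) by blast
        qed
        moreover have "0 \<le> S"
          unfolding S_def using clique_spectral_radius_nonneg[OF fin neV] k(4) by (intro sum_nonneg) auto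
        ultimately have "S ^ k \<le> real (2 ^ k * (Suc s * (\<Sum>i<s. (card ?V - k) choose i))) ^ k"
          by (rule power_mono)
        also have "\<dots> \<le> q ^ (s * (k - 1))" using q(2) assms(6) by simp
        also have "\<dots> < real (m div s) ^ (s * (k - 1))"
          using qa q(1) s k(4) by (intro power_strict_mono) auto
        also have "\<dots> = real ((m div s) ^ s) ^ (k - 1)" by (simp add: power_mult)
        also have "\<dots> \<le> real ?P ^ (k - 1)"
        proof (intro power_mono)
          have "(m div s) ^ s = (m div s) ^ (s - m mod s) * (m div s) ^ (m mod s)"
            using s by (simp flip: power_add)
          also have "\<dots> \<le> ?P" unfolding balanced_product_def by (intro mult_le_mono2 power_mono) auto
          finally show "real ((m div s) ^ s) \<le> real ?P" by (simp only: of_nat_le_iff)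
        qed simp
        finally show ?thesis .
      qed
      then show ?thesis using strict by blast
    qed
    then show ?thesis using iso kr assms(1) by auto
  qed
  have "{k..k + s} = {k..2 * r - 1}" using k(3) by simp
  then show ?thesis using main unfolding S_def H_def t_def s_def m_def by simp
qed

end
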